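(* Assume Schanuel's conjecture holds. Let $f_1,f_2$ be non-zero exponential polynomials over $\overline{\mathbb Q}$. Then $f_1/\gcd(f_1,f_2)$ and $f_2/\gcd(f_1,f_2)$ have no common zero in $\mathbb C^*$. Equivalently, the common zeros of $f_1$ and $f_2$ in $\mathbb C^*$ are exactly the zeros of $\gcd(f_1,f_2)$ in $\mathbb C^*$, and for any such zero $\xi$ the order of vanishing of $\gcd(f_1,f_2)$ at $\xi$ is the minimum of the orders of vanishing of $f_1$ and $f_2$ at $\xi$.
   Context: An exponential polynomial over $\overline{\mathbb Q}$ is a function $f(x)=\sum_{i=1}^N P_i(x)e^{\beta_i x}$ with $N\ge1$, $P_i\in\overline{\mathbb Q}[X]$, $\beta_i\in\overline{\mathbb Q}$. These form a ring $\mathcal P$ whose units are the functions $\lambda e^{\alpha x}$ with $\lambda,\alpha\in\overline{\mathbb Q}$, $\lambda\neq0$. Divisibility refers to the ring $\mathcal P$; $\gcd(f_1,f_2)$ denotes a greatest common divisor in $\mathcal P$ (a common divisor divisible in $\mathcal P$ by every common divisor), which exists and is unique up to units. Schanuel's conjecture: if $x_1,\dots,x_n\in\mathbb C$ are linearly independent over $\mathbb Q$, then $\overline{\mathbb Q}(x_1,\dots,x_n,e^{x_1},\dots,e^{x_n})$ has transcendence degree at least $n$ over $\overline{\mathbb Q}$. *)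

theory Defs
  imports
    "HOL-Algebra.Algebraic_Closure_Type"
    "HOL-Algebra.Divisibility"
    "HOL-Algebra.Generated_Fields"
    "HOL-Library.Poly_Mapping"
    "HOL-Library.Extended_Nat"
    "HOL-Complex_Analysis.Complex_Analysis"
begin

definition algebraic_numbers :: "complex set" where
  "algebraic_numbers = {z. algebraic z}"


section \<open>Exponential polynomials\<close>

definition exp_poly :: "(complex \<Rightarrow> complex) \<Rightarrow> bool" where
  "exp_poly f \<longleftrightarrow>
     (\<exists>(N::nat) (P :: nat \<Rightarrow> complex poly) (\<beta> :: nat \<Rightarrow> complex).
        N \<ge> 1 \<and>
        (\<forall>i<N. (\<forall>j. coeff (P i) j \<in> algebraic_numbers) \<and> \<beta> i \<in> algebraic_numbers) \<and>
        f = (\<lambda>x. \<Sum>i<N. poly (P i) x * exp (\<beta> i * x)))"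

definition exp_poly_ring :: "(complex \<Rightarrow> complex) ring" where
  "exp_poly_ring =
     \<lparr>carrier = {f. exp_poly f},
      monoid.mult = (\<lambda>f g x. f x * g x),
      monoid.one = (\<lambda>x. 1),
      ring.zero = (\<lambda>x. 0),
      ring.add = (\<lambda>f g x. f x + g x)\<rparr>"


section \<open>Transcendence degree and Schanuel's conjecture\<close>

text \<open>A polynomial in variables indexed by \<open>nat\<close> is a finitely supported map from monomials
  (finitely supported exponent functions) to coefficients.\<close>

definition mpoly_eval :: "(nat \<Rightarrow> complex) \<Rightarrow> ((nat \<Rightarrow>\<^sub>0 nat) \<Rightarrow>\<^sub>0 complex) \<Rightarrow> complex" where
  "mpoly_eval y p =
     (\<Sum>m\<in>Poly_Mapping.keys p. Poly_Mapping.lookup p m * (\<Prod>i\<in>Poly_Mapping.keys m. y i ^ Poly_Mapping.lookup m i))"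

definition alg_independent_over :: "complex set \<Rightarrow> nat \<Rightarrow> (nat \<Rightarrow> complex) \<Rightarrow> bool" where
  "alg_independent_over K n y \<longleftrightarrow>
     (\<forall>p. (\<forall>m\<in>Poly_Mapping.keys p. Poly_Mapping.keys m \<subseteq> {..<n} \<and> Poly_Mapping.lookup p m \<in> K) \<and> mpoly_eval y p = 0 \<longrightarrow> p = 0)"

text \<open>The largest length of a \<open>K\<close>-algebraically independent family in \<open>L\<close>; it is \<open>\<infinity>\<close> if
  these lengths are unbounded.\<close>

definition transcendence_degree :: "complex set \<Rightarrow> complex set \<Rightarrow> enat" where
  "transcendence_degree K L =
     Sup {enat n | n y. y ` {..<n} \<subseteq> L \<and> alg_independent_over K n y}"

text \<open>Linear independence of a family means that the family is injective and its range is an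
  independent set; \<open>\<complex>\<close> is viewed as a vector space over the type \<open>rat\<close>.\<close>

definition rat_independent :: "nat \<Rightarrow> (nat \<Rightarrow> complex) \<Rightarrow> bool" where
  "rat_independent n x \<longleftrightarrow>
     inj_on x {..<n} \<and>
     \<not> Modules.module.dependent (\<lambda>(q::rat) (z::complex). of_rat q * z) (x ` {..<n})"

definition schanuel_conjecture :: bool where
  "schanuel_conjecture \<longleftrightarrow>
     (\<forall>(n::nat) (x :: nat \<Rightarrow> complex). rat_independent n x \<longrightarrow>
        transcendence_degree algebraic_numbers
          (generate_field ring_of_type_algebra
             (algebraic_numbers \<union> x ` {..<n} \<union> (\<lambda>i. exp (x i)) ` {..<n})) \<ge> enat n)"

end

theory Submission
  imports Defs
begin

text \<open>If the cofactors \<open>h\<^sub>1 = f\<^sub>1 / g\<close> and \<open>h\<^sub>2 = f\<^sub>2 / g\<close> both vanish at \<open>\<xi> \<noteq> 0\<close>, they have a common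
  divisor vanishing at \<open>\<xi>\<close>, which contradicts the choice of \<open>g\<close>. Choose \<open>b\<^sub>1, \<dots>, b\<^sub>n\<close> linearly
  independent over the rationals such that all frequencies are integral combinations of them. Up
  to units, \<open>h\<^sub>1\<close> and \<open>h\<^sub>2\<close> are polynomials in \<open>x, exp (b\<^sub>1 x), \<dots>, exp (b\<^sub>n x)\<close>. By Schanuel's
  conjecture for \<open>b\<^sub>1 \<xi>, \<dots>, b\<^sub>n \<xi>\<close>, the values of these \<open>n + 1\<close> functions at \<open>\<xi>\<close> have
  transcendence degree at least \<open>n\<close>. So \<open>n\<close> of the values generate a polynomial ring, which is
  factorial, and by Gauss' lemma the primitive minimal polynomial of the remaining value divides the
  polynomials of \<open>h\<^sub>1\<close> and \<open>h\<^sub>2\<close> over this ring.\<close>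

section \<open>Subrings and polynomials over them\<close>

text \<open>Schanuel's conjecture does not tell which of the \<open>n + 1\<close> values is the
  remaining one: it may be the point \<xi> itself or the value of an exponential. So the argument
  must not depend on the roles of the variables. The coefficients have to stay in the polynomial
  ring and may not lie in its field of fractions, because quotients of functions would leave the
  ring of exponential polynomials; this is what makes Gauss' lemma necessary. Instead of
  indeterminates, the values at \<xi> themselves are used: the coefficient rings are sets of complex
  numbers, built by adjoining one element at a time, and independence takes the form that each
  element is transcendental over the preceding ones. Such a ring knows the functions only through
  their values at \<xi>; the functions are recovered by homomorphisms that exist because independent
  values can be sent anywhere. The condition that \<xi> is nonzero enters through the linear
  independence of the numbers \<open>b\<^sub>i \<xi>\<close>.\<close>

locale subring_set =
  fixes R :: "'a::comm_ring_1 set"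
  assumes one_mem: "1 \<in> R"
    and diff_mem: "a \<in> R \<Longrightarrow> b \<in> R \<Longrightarrow> a - b \<in> R"
    and mult_mem: "a \<in> R \<Longrightarrow> b \<in> R \<Longrightarrow> a * b \<in> R"
begin

lemma zero_mem: "0 \<in> R"
  using diff_mem[OF one_mem one_mem] by simp

lemma uminus_mem: "a \<in> R \<Longrightarrow> - a \<in> R"
  using diff_mem[OF zero_mem] by force

lemma add_mem: "a \<in> R \<Longrightarrow> b \<in> R \<Longrightarrow> a + b \<in> R"
  using diff_mem[of a "- b"] uminus_mem[of b] by simp

lemma sum_mem: "(\<And>i. i \<in> I \<Longrightarrow> f i \<in> R) \<Longrightarrow> sum f I \<in> R"
  by (induction I rule: infinite_finite_induct) (auto intro: zero_mem add_mem)

lemma power_mem: "a \<in> R \<Longrightarrow> a ^ n \<in> R"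
  by (induction n) (auto intro: one_mem mult_mem)

end

definition polys_over :: "'a::zero set \<Rightarrow> 'a poly set" where
  "polys_over R = {p. \<forall>i. coeff p i \<in> R}"

lemma polys_over_coeff: "p \<in> polys_over R \<Longrightarrow> coeff p i \<in> R"
  by (simp add: polys_over_def)

lemma polys_over_mono: "R \<subseteq> S \<Longrightarrow> polys_over R \<subseteq> polys_over S"
  by (auto simp: polys_over_def)

context subring_set
begin

lemma polys_over_subring: "subring_set (polys_over R)"
proof
  show "1 \<in> polys_over R"
    by (auto simp: polys_over_def one_mem zero_mem)
  show "p - q \<in> polys_over R" if "p \<in> polys_over R" "q \<in> polys_over R" for p q
    using that by (auto simp: polys_over_def diff_mem)
  show "p * q \<in> polys_over R" if "p \<in> polys_over R" "q \<in> polys_over R" for p q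
    using that by (auto simp: polys_over_def coeff_mult intro!: sum_mem mult_mem)
qed

lemmas polys_zero_mem = subring_set.zero_mem[OF polys_over_subring]
  and polys_one_mem = subring_set.one_mem[OF polys_over_subring]
  and polys_diff_mem = subring_set.diff_mem[OF polys_over_subring]
  and polys_add_mem = subring_set.add_mem[OF polys_over_subring]
  and polys_mult_mem = subring_set.mult_mem[OF polys_over_subring]
  and polys_sum_mem = subring_set.sum_mem[OF polys_over_subring]

lemma monom_polys_over: "c \<in> R \<Longrightarrow> monom c n \<in> polys_over R"
  by (auto simp: polys_over_def zero_mem)

lemma const_polys_over: "c \<in> R \<Longrightarrow> [:c:] \<in> polys_over R"
  using monom_polys_over[of c 0] by (simp add: monom_0)

lemma pCons_polys_over: "c \<in> R \<Longrightarrow> p \<in> polys_over R \<Longrightarrow> pCons c p \<in> polys_over R"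
  by (auto simp: polys_over_def coeff_pCons split: nat.split)

lemma smult_polys_over: "c \<in> R \<Longrightarrow> p \<in> polys_over R \<Longrightarrow> smult c p \<in> polys_over R"
  by (auto simp: polys_over_def mult_mem)

lemma poly_mem: "p \<in> polys_over R \<Longrightarrow> x \<in> R \<Longrightarrow> poly p x \<in> R"
  by (auto simp: poly_altdef polys_over_coeff intro!: sum_mem mult_mem power_mem)

lemma eval_image_subring: "subring_set ((\<lambda>p. poly p x) ` polys_over R)"
proof
  let ?I = "(\<lambda>p. poly p x) ` polys_over R"
  show "1 \<in> ?I"
    by (rule image_eqI[of _ _ 1]) (auto intro: polys_one_mem)
  show "a - b \<in> ?I" "a * b \<in> ?I" if "a \<in> ?I" "b \<in> ?I" for a b
  proof -
    from that obtain p q where "a = poly p x" "p \<in> polys_over R" "b = poly q x" "q \<in> polys_over R"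
      by blast
    then show "a - b \<in> ?I" "a * b \<in> ?I"
      using imageI[OF polys_diff_mem[of p q], of "\<lambda>p. poly p x"]
        imageI[OF polys_mult_mem[of p q], of "\<lambda>p. poly p x"] by simp_all
  qed
qed

end

inductive_set ring_gen :: "'a::comm_ring_1 set \<Rightarrow> 'a set" for H where
  ring_gen_one: "1 \<in> ring_gen H"
| ring_gen_incl: "h \<in> H \<Longrightarrow> h \<in> ring_gen H"
| ring_gen_diff: "a \<in> ring_gen H \<Longrightarrow> b \<in> ring_gen H \<Longrightarrow> a - b \<in> ring_gen H"
| ring_gen_mult: "a \<in> ring_gen H \<Longrightarrow> b \<in> ring_gen H \<Longrightarrow> a * b \<in> ring_gen H"

interpretation ring_gen: subring_set "ring_gen H" for H
  by unfold_locales (auto intro: ring_gen.intros)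

lemma ring_gen_least:
  assumes "subring_set R" "H \<subseteq> R"
  shows "ring_gen H \<subseteq> R"
proof
  interpret subring_set R by fact
  show "x \<in> R" if "x \<in> ring_gen H" for x
    using that assms(2) by induction (auto intro: one_mem diff_mem mult_mem)
qed

lemma ring_gen_mono: "H \<subseteq> H' \<Longrightarrow> ring_gen H \<subseteq> ring_gen H'"
  by (rule ring_gen_least[OF ring_gen.subring_set_axioms]) (auto intro: ring_gen_incl)

text \<open>Adjoining one element means evaluating univariate polynomials there. This allows an
  induction over the generators to take the place of multivariate polynomials.\<close>

lemma ring_gen_insert:
  "ring_gen (insert x H) = (\<lambda>p. poly p x) ` polys_over (ring_gen H)"
proof
  show "ring_gen (insert x H) \<subseteq> (\<lambda>p. poly p x) ` polys_over (ring_gen H)"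
  proof (rule ring_gen_least[OF ring_gen.eval_image_subring])
    have "[:0, 1:] \<in> polys_over (ring_gen H)"
      by (intro ring_gen.pCons_polys_over ring_gen.polys_zero_mem ring_gen.one_mem ring_gen.zero_mem)
    moreover have "[:h:] \<in> polys_over (ring_gen H)" if "h \<in> H" for h
      using that by (intro ring_gen.const_polys_over ring_gen_incl)
    ultimately show "insert x H \<subseteq> (\<lambda>p. poly p x) ` polys_over (ring_gen H)"
      by (auto intro: image_eqI[of _ _ "[:0, 1:]"] image_eqI[of h _ "[:h:]" for h])
  qed
  have "polys_over (ring_gen H) \<subseteq> polys_over (ring_gen (insert x H))"
    by (intro polys_over_mono ring_gen_mono) auto
  moreover have "x \<in> ring_gen (insert x H)"
    by (rule ring_gen_incl) simp
  ultimately show "(\<lambda>p. poly p x) ` polys_over (ring_gen H) \<subseteq> ring_gen (insert x H)"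
    using ring_gen.poly_mem[of _ "insert x H" x] by auto
qed

section \<open>Relative algebraic closure\<close>

definition algebraic_over :: "'a::comm_ring_1 set \<Rightarrow> 'a \<Rightarrow> bool" where
  "algebraic_over R x \<longleftrightarrow> (\<exists>p\<in>polys_over R. p \<noteq> 0 \<and> poly p x = 0)"

text \<open>Coefficients come from the generated ring instead of the generated field; in a field
  both give the same elements, since denominators can be cleared.\<close>

definition alg_cl :: "'a::comm_ring_1 set \<Rightarrow> 'a set" where
  "alg_cl H = {x. algebraic_over (ring_gen H) x}"

lemma algebraic_over_mono: "R \<subseteq> S \<Longrightarrow> algebraic_over R x \<Longrightarrow> algebraic_over S x"
  using polys_over_mono[of R S] by (auto simp: algebraic_over_def)

lemma alg_cl_mono: "H \<subseteq> H' \<Longrightarrow> alg_cl H \<subseteq> alg_cl H'"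
  using algebraic_over_mono[OF ring_gen_mono] by (auto simp: alg_cl_def)

lemma (in subring_set) mem_imp_algebraic_over:
  assumes "x \<in> R" shows "algebraic_over R x"
  unfolding algebraic_over_def
  by (rule bexI[of _ "[:- x, 1:]"])
     (auto intro!: pCons_polys_over polys_zero_mem one_mem uminus_mem assms)

lemma ring_gen_subset_alg_cl: "ring_gen H \<subseteq> alg_cl H"
  by (auto simp: alg_cl_def intro: ring_gen.mem_imp_algebraic_over)

lemma finite_common_denominator:
  fixes R :: "'a::field set"
  assumes "subring_set R" "finite I"
    and "\<And>i. i \<in> I \<Longrightarrow> \<exists>a\<in>R. \<exists>b\<in>R. b \<noteq> 0 \<and> f i = a / b"
  shows "\<exists>d\<in>R. d \<noteq> 0 \<and> (\<forall>i\<in>I. d * f i \<in> R)"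
  using assms(2,3)
proof (induction I)
  case empty
  then show ?case using subring_set.one_mem[OF assms(1)] by (auto intro!: bexI[of _ 1])
next
  case (insert i I)
  interpret subring_set R by fact
  obtain d where d: "d \<in> R" "d \<noteq> 0" "\<forall>i\<in>I. d * f i \<in> R"
    using insert by auto
  obtain a b where ab: "a \<in> R" "b \<in> R" "b \<noteq> 0" "f i = a / b"
    using insert.prems[of i] by auto
  have "b * d * f j \<in> R" if "j \<in> I" for j
    using mult_mem[OF ab(2) d(3)[rule_format, OF that]] by (simp add: mult.assoc)
  moreover have "b * d * f i = d * a" using ab by simp
  ultimately show ?case
    using ab d by (intro bexI[of _ "b * d"]) (auto intro: mult_mem)
qed

lemma algebraic_over_fractions:
  fixes R F :: "'a::field set"
  assumes "subring_set R" "algebraic_over F x"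
    and F: "\<And>y. y \<in> F \<Longrightarrow> \<exists>a\<in>R. \<exists>b\<in>R. b \<noteq> 0 \<and> y = a / b"
  shows "algebraic_over R x"
proof -
  interpret subring_set R by fact
  obtain p where p: "p \<in> polys_over F" "p \<noteq> 0" "poly p x = 0"
    using assms(2) by (auto simp: algebraic_over_def)
  obtain d where d: "d \<in> R" "d \<noteq> 0" "\<forall>i\<in>{..degree p}. d * coeff p i \<in> R"
    using finite_common_denominator[OF assms(1), of "{..degree p}" "coeff p"]
      F polys_over_coeff[OF p(1)] by auto
  have "d * coeff p i \<in> R" for i
    using d(3) zero_mem coeff_eq_0[of p i] by (cases "i \<le> degree p") auto
  then have "smult d p \<in> polys_over R" by (auto simp: polys_over_def)
  then show ?thesis
    using p d by (auto simp: algebraic_over_def intro!: bexI[of _ "smult d p"])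
qed

section \<open>Comparison of a field given as a type with the theory of subfields and finite
  extensions\<close>

abbreviation type_ring :: "'a::field ring" where
  "type_ring \<equiv> ring_of_type_algebra"

lemma type_ring_simps [simp]:
  "carrier type_ring = UNIV"
  "\<zero>\<^bsub>type_ring\<^esub> = (0::'a::field)"
  "\<one>\<^bsub>type_ring\<^esub> = (1::'a)"
  "a \<otimes>\<^bsub>type_ring\<^esub> b = (a * b::'a)"
  "a \<oplus>\<^bsub>type_ring\<^esub> b = (a + b::'a)"
  by (simp_all add: ring_of_type_algebra_def)

lemma type_ring_field: "field (type_ring :: 'a::field ring)"
  by (rule field_from_type_algebra)

lemma type_ring_a_inv [simp]: "\<ominus>\<^bsub>type_ring\<^esub> (a::'a::field) = - a"
proof -
  interpret field "type_ring :: 'a ring" by (rule type_ring_field)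
  show ?thesis using minus_equality[of "- a" a] by simp
qed

lemma type_ring_m_inv [simp]:
  assumes "a \<noteq> 0" shows "inv\<^bsub>type_ring\<^esub> (a::'a::field) = inverse a"
proof -
  interpret field "type_ring :: 'a ring" by (rule type_ring_field)
  show ?thesis using inv_unique'[of a "inverse a"] assms by simp
qed

lemma type_ring_pow [simp]: "(a::'a::field) [^]\<^bsub>type_ring\<^esub> (n::nat) = a ^ n"
  by (induction n) (simp_all add: mult.commute)

text \<open>\<open>ring.eval\<close> reads a list with the leading coefficient first,
  \<open>Poly\<close> with the constant term first; hence the reversal.\<close>

lemma type_ring_eval:
  "ring.eval (type_ring :: 'a::field ring) xs x = poly (Poly (rev xs)) x"
proof -
  interpret field "type_ring :: 'a ring" by (rule type_ring_field)
  show ?thesis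
  proof (induction xs)
    case (Cons a xs)
    then show ?case
      by (simp add: Poly_append poly_monom mult.commute add.commute)
  qed simp
qed

lemma Poly_rev_polys_over:
  assumes "set xs \<subseteq> K" "0 \<in> K" "xs \<noteq> []" "hd xs \<noteq> 0"
  shows "Poly (rev xs) \<in> polys_over K" "Poly (rev xs) \<noteq> 0"
proof -
  show "Poly (rev xs) \<in> polys_over K"
    using assms(1,2) by (auto simp: polys_over_def nth_default_def subset_iff rev_nth)
  have "coeff (Poly (rev xs)) (length xs - 1) \<noteq> 0"
    using assms(3,4) by (auto simp: nth_default_def rev_nth hd_conv_nth)
  then show "Poly (rev xs) \<noteq> 0" by (metis coeff_0)
qed

lemma polys_over_iff_coeffs:
  assumes "0 \<in> K" shows "p \<in> polys_over K \<longleftrightarrow> set (coeffs p) \<subseteq> K"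
proof -
  have "p \<in> polys_over K \<longleftrightarrow> range (coeff p) \<subseteq> K" by (auto simp: polys_over_def)
  then show ?thesis using assms by (simp add: range_coeff)
qed

lemma type_ring_algebraic_iff:
  assumes "subring_set (K :: 'a::field set)"
  shows "(ring.algebraic type_ring over K) x \<longleftrightarrow> algebraic_over K x"
proof -
  interpret field "type_ring :: 'a ring" by (rule type_ring_field)
  interpret K: subring_set K by fact
  have sr: "subring K type_ring"
    by (rule subringI) (auto intro: K.uminus_mem K.one_mem K.mult_mem K.add_mem)
  show ?thesis
  proof
    assume "(algebraic over K) x"
    then obtain xs where xs: "xs \<in> carrier (K[X]\<^bsub>type_ring\<^esub>)" "xs \<noteq> []" "eval xs x = \<zero>\<^bsub>type_ring\<^esub>"
      using algebraicE[OF sr] by auto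
    let ?p = "Poly (rev xs)"
    have K: "set xs \<subseteq> K" "hd xs \<noteq> 0"
      using xs unfolding univ_poly_def polynomial_def by auto
    have "?p \<in> polys_over K" "?p \<noteq> 0"
      using Poly_rev_polys_over[OF K(1) K.zero_mem xs(2) K(2)] .
    then show "algebraic_over K x"
      using xs(3) by (auto simp: algebraic_over_def type_ring_eval)
  next
    assume "algebraic_over K x"
    then obtain p where p: "p \<in> polys_over K" "p \<noteq> 0" "poly p x = 0"
      by (auto simp: algebraic_over_def)
    let ?xs = "rev (coeffs p)"
    have "set ?xs \<subseteq> K"
      using p(1) by (simp add: polys_over_iff_coeffs[OF K.zero_mem])
    moreover have "hd ?xs \<noteq> 0" "?xs \<noteq> []"
      using p(2) by (auto simp: hd_rev last_coeffs_eq_coeff_degree)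
    ultimately have "?xs \<in> carrier (K[X]\<^bsub>type_ring\<^esub>)"
      unfolding univ_poly_def polynomial_def by auto
    then show "(algebraic over K) x"
      using algebraicI[of ?xs K x] \<open>?xs \<noteq> []\<close> p(3) by (simp add: type_ring_eval)
  qed
qed

lemma subfield_type_ringI:
  assumes "subring_set (K :: 'a::field set)" "\<And>x. x \<in> K \<Longrightarrow> inverse x \<in> K"
  shows "subfield K type_ring"
proof -
  interpret field "type_ring :: 'a ring" by (rule type_ring_field)
  interpret K: subring_set K by fact
  show ?thesis
    by (rule subfieldI'[OF subringI])
       (auto intro: K.uminus_mem K.one_mem K.mult_mem K.add_mem assms)
qed

lemma subfield_type_ringD:
  assumes "subfield (K :: 'a::field set) type_ring"
  shows "subring_set K" "\<And>x. x \<in> K \<Longrightarrow> inverse x \<in> K"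
proof -
  interpret field "type_ring :: 'a ring" by (rule type_ring_field)
  have sr: "subring K type_ring" using assms by (simp add: subfieldE)
  show "subring_set K"
  proof
    show "1 \<in> K" using subringE(3)[OF sr] by simp
    show "a * b \<in> K" if "a \<in> K" "b \<in> K" for a b using subringE(6)[OF sr that] by simp
    show "a - b \<in> K" if "a \<in> K" "b \<in> K" for a b
      using subringE(7)[OF sr that(1) subringE(5)[OF sr that(2)]] by simp
  qed
  show "inverse x \<in> K" if "x \<in> K" for x
    using subfield_m_inv(1)[OF assms, of x] that by (cases "x = 0") auto
qed

lemma fractions_of_subring:
  fixes R :: "'a::field set"
  assumes "subring_set R"
  defines "F \<equiv> {a / b | a b. a \<in> R \<and> b \<in> R \<and> b \<noteq> 0}"
  shows "subfield F type_ring" "R \<subseteq> F"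
proof -
  interpret subring_set R by fact
  show "R \<subseteq> F"
    unfolding F_def using one_mem by force
  have F: "a / b \<in> F" if "a \<in> R" "b \<in> R" "b \<noteq> 0" for a b
    using that by (auto simp: F_def)
  show "subfield F type_ring"
  proof (rule subfield_type_ringI)
    show "subring_set F"
    proof
      show "1 \<in> F" using F[OF one_mem one_mem] by simp
      fix x y assume "x \<in> F" "y \<in> F"
      then obtain a b c d where *: "x = a / b" "a \<in> R" "b \<in> R" "b \<noteq> 0"
        "y = c / d" "c \<in> R" "d \<in> R" "d \<noteq> 0" by (auto simp: F_def)
      have "x - y = (a * d - c * b) / (b * d)" "x * y = (a * c) / (b * d)"
        using * by (auto simp: field_simps)
      then show "x - y \<in> F" "x * y \<in> F"
        using * by (auto intro!: F mult_mem diff_mem)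
    qed
    show "inverse x \<in> F" if "x \<in> F" for x
    proof (cases "x = 0")
      case False
      then obtain a b where "x = a / b" "a \<in> R" "b \<in> R" "b \<noteq> 0" "a \<noteq> 0"
        using \<open>x \<in> F\<close> by (auto simp: F_def)
      then show ?thesis using F[of b a] by simp
    qed (use \<open>x \<in> F\<close> in simp)
  qed
qed

text \<open>Finitely many elements algebraic over a field lie in an extension of finite dimension,
  and every element of such an extension is algebraic.\<close>

lemma algebraic_over_trans_field:
  fixes K :: "'a::field set"
  assumes "subfield K type_ring" "algebraic_over {x. algebraic_over K x} y"
  shows "algebraic_over K y"
proof -
  interpret field "type_ring :: 'a ring" by (rule type_ring_field)
  note K = subfield_type_ringD(1)[OF assms(1)]
  interpret K: subring_set K by fact
  obtain p where p: "p \<in> polys_over {x. algebraic_over K x}" "p \<noteq> 0" "poly p y = 0"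
    using assms(2) by (auto simp: algebraic_over_def[of "{x. algebraic_over K x}"])
  define E where "E = finite_extension K (coeffs p)"
  have alg: "(algebraic over K) x" if "x \<in> set (coeffs p)" for x
    using that p(1) K.mem_imp_algebraic_over[OF K.zero_mem]
    by (auto simp: type_ring_algebraic_iff[OF K] polys_over_iff_coeffs)
  have E: "subfield E type_ring" "finite_dimension K E"
    unfolding E_def using alg finite_extension_is_subfield[OF assms(1), of "coeffs p"]
      finite_extension_finite_dimension(1)[OF assms(1), of "coeffs p"] by simp_all
  have "set (coeffs p) \<subseteq> E"
    unfolding E_def using finite_extension_mem[OF subfieldE(1)[OF assms(1)]] by simp
  moreover have "0 \<in> E" using subfield_type_ringD(1)[OF E(1)] by (rule subring_set.zero_mem)
  ultimately have "p \<in> polys_over E"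
    by (simp add: polys_over_iff_coeffs)
  then have "algebraic_over E y" using p by (auto simp: algebraic_over_def)
  then have y: "(algebraic over E) y"
    using type_ring_algebraic_iff[OF subfield_type_ringD(1)[OF E(1)]] by simp
  have "finite_dimension E (simple_extension E y)"
    using finite_dimension_simple_extension[OF E(1)] y by simp
  then have "finite_dimension K (simple_extension E y)"
    by (rule telescopic_base_dim(1)[OF assms(1) E])
  then have "(algebraic over K) y"
    using finite_dimension_imp_algebraic[OF assms(1)
        simple_extension_is_subring[OF subfieldE(1)[OF E(1)]], of y y]
      simple_extension_mem[OF subfieldE(1)[OF E(1)], of y] by simp
  then show ?thesis using type_ring_algebraic_iff[OF K] by simp
qed

text \<open>The field of fractions of the generated ring serves as \<open>K\<close>, so that the
  results on elements algebraic over a subfield apply to \<open>alg_cl\<close>.\<close>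

lemma alg_cl_eq_field:
  fixes H :: "'a::field set"
  obtains K where "subfield K type_ring" "ring_gen H \<subseteq> K" "alg_cl H = {x. algebraic_over K x}"
proof
  define K where "K = {a / b | a b. a \<in> ring_gen H \<and> b \<in> ring_gen H \<and> b \<noteq> 0}"
  show "subfield K type_ring" "ring_gen H \<subseteq> K"
    using fractions_of_subring[OF ring_gen.subring_set_axioms, of H] by (auto simp: K_def)
  moreover have "algebraic_over (ring_gen H) x" if "algebraic_over K x" for x
    by (rule algebraic_over_fractions[OF ring_gen.subring_set_axioms that]) (auto simp: K_def)
  ultimately show "alg_cl H = {x. algebraic_over K x}"
    using algebraic_over_mono[of "ring_gen H" K] by (auto simp: alg_cl_def)
qed

lemma alg_cl_subfield: "subfield (alg_cl (H :: 'a::field set)) type_ring"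
proof -
  interpret field "type_ring :: 'a ring" by (rule type_ring_field)
  obtain K where K: "subfield K type_ring" "alg_cl H = {x. algebraic_over K x}"
    using alg_cl_eq_field by metis
  then show ?thesis
    using subfield_of_algebraics[OF K(1)] type_ring_algebraic_iff[OF subfield_type_ringD(1)[OF K(1)]]
    by simp
qed

interpretation alg_cl: subring_set "alg_cl (H :: 'a::field set)" for H
  by (rule subfield_type_ringD(1)[OF alg_cl_subfield])

lemma alg_cl_inverse: "x \<in> alg_cl H \<Longrightarrow> inverse x \<in> alg_cl (H :: 'a::field set)"
  by (rule subfield_type_ringD(2)[OF alg_cl_subfield])

lemma alg_cl_incl: "H \<subseteq> alg_cl H"
  using ring_gen_subset_alg_cl[of H] by (auto intro: ring_gen_incl)

lemma alg_cl_algebraic_closed: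
  fixes H :: "'a::field set"
  assumes "algebraic_over (alg_cl H) x" shows "x \<in> alg_cl H"
proof -
  obtain K where K: "subfield K type_ring" "alg_cl H = {x. algebraic_over K x}"
    using alg_cl_eq_field by metis
  then show ?thesis using algebraic_over_trans_field[OF K(1)] assms by simp
qed

lemma alg_cl_least:
  fixes H :: "'a::field set"
  assumes "H' \<subseteq> alg_cl H" shows "alg_cl H' \<subseteq> alg_cl H"
proof
  fix x assume "x \<in> alg_cl H'"
  moreover have "ring_gen H' \<subseteq> alg_cl H"
    by (rule ring_gen_least[OF alg_cl.subring_set_axioms assms])
  ultimately show "x \<in> alg_cl H"
    using algebraic_over_mono by (auto simp: alg_cl_def[of H'] intro!: alg_cl_algebraic_closed)
qed

section \<open>Exchange property and transcendence bases\<close>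

lemma alg_cl_exchange:
  fixes H :: "'a::field set"
  assumes c: "c \<in> alg_cl (insert b H)" "c \<notin> alg_cl H"
  shows "b \<in> alg_cl (insert c H)"
proof -
  obtain p where p: "p \<in> polys_over (ring_gen (insert b H))" "p \<noteq> 0" "poly p c = 0"
    using c(1) by (auto simp: alg_cl_def algebraic_over_def)
  have "\<exists>q\<in>polys_over (ring_gen H). coeff p j = poly q b" for j
    using polys_over_coeff[OF p(1), of j] by (auto simp: ring_gen_insert)
  then obtain P where P: "\<And>j. P j \<in> polys_over (ring_gen H)" "\<And>j. coeff p j = poly (P j) b"
    by metis
  define d where "d = degree p"
  \<comment> \<open>The relation for \<open>c\<close> is a double sum in powers of \<open>b\<close>
    and \<open>c\<close>. Here it is grouped by powers of \<open>b\<close>, which are then replaced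
    by an unknown.\<close>
  define Q where "Q = (\<Sum>j\<le>d. smult (c ^ j) (P j))"
  have coeff_Q: "coeff Q i = poly (\<Sum>j\<le>d. monom (coeff (P j) i) j) c" for i
    by (simp add: Q_def coeff_sum poly_sum poly_monom mult.commute)
  have "coeff Q i \<in> ring_gen (insert c H)" for i
    unfolding coeff_Q ring_gen_insert
    by (intro imageI ring_gen.polys_sum_mem ring_gen.monom_polys_over polys_over_coeff P)
  then have "Q \<in> polys_over (ring_gen (insert c H))"
    by (simp add: polys_over_def)
  moreover have "poly Q b = 0"
    using p(3) by (simp add: Q_def poly_sum poly_altdef[of p] P d_def mult.commute)
  moreover have "Q \<noteq> 0"
  proof
    assume "Q = 0"
    \<comment> \<open>Below, \<open>?r\<close> is the coefficient of \<open>Q\<close> at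
      \<open>i\<close> with an unknown in place of \<open>c\<close>. If \<open>Q\<close> vanished,
      \<open>?r\<close> would be a nonzero polynomial over \<open>ring_gen H\<close> with the root
      \<open>c\<close>, although \<open>c\<close> is not in \<open>alg_cl H\<close>.\<close>
    have "P d \<noteq> 0" using P(2)[of d] p(2) by (auto simp: d_def)
    then obtain i where i: "coeff (P d) i \<noteq> 0" by (auto simp: poly_eq_iff)
    let ?r = "\<Sum>j\<le>d. monom (coeff (P j) i) j"
    have "coeff ?r d = coeff (P d) i" by (simp add: coeff_sum)
    then have "?r \<noteq> 0" using i by auto
    moreover have "?r \<in> polys_over (ring_gen H)"
      by (intro ring_gen.polys_sum_mem ring_gen.monom_polys_over polys_over_coeff P)
    moreover have "poly ?r c = 0" using coeff_Q[of i] \<open>Q = 0\<close> by simp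
    ultimately show False using c(2) by (auto simp: alg_cl_def algebraic_over_def)
  qed
  ultimately show ?thesis by (auto simp: alg_cl_def algebraic_over_def)
qed

text \<open>Elements of \<open>T\<close> are discarded as long as \<open>y\<close> stays in the
  closure; the one whose removal would lose \<open>y\<close> is exchanged for \<open>y\<close>. It
  exists because \<open>y\<close> is not in the closure of \<open>Y\<close> alone.\<close>

lemma alg_cl_steinitz_step:
  fixes Y :: "'a::field set"
  assumes "finite T" "y \<in> alg_cl (Y \<union> T)" "y \<notin> alg_cl Y"
  shows "\<exists>t\<in>T. t \<in> alg_cl (insert y (Y \<union> (T - {t})))"
  using assms
proof (induction T)
  case (insert t T)
  show ?case
  proof (cases "y \<in> alg_cl (Y \<union> T)")
    case True
    then obtain s where s: "s \<in> T" "s \<in> alg_cl (insert y (Y \<union> (T - {s})))"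
      using insert by auto
    moreover have "alg_cl (insert y (Y \<union> (T - {s}))) \<subseteq> alg_cl (insert y (Y \<union> (insert t T - {s})))"
      by (rule alg_cl_mono) auto
    ultimately show ?thesis by (intro bexI[of _ s]) auto
  next
    case False
    moreover have "y \<in> alg_cl (insert t (Y \<union> T))" using insert.prems(1) by simp
    ultimately have "t \<in> alg_cl (insert y (Y \<union> T))" by (rule alg_cl_exchange[rotated])
    moreover have "insert t T - {t} = T" using insert.hyps by auto
    ultimately show ?thesis by (metis insertI1)
  qed
qed simp

text \<open>Steinitz exchange: the elements \<open>y i\<close> enter one after the other, each in
  place of one element of \<open>T\<close>, so \<open>T\<close> has to supply \<open>n\<close> of
  them. By \<open>indep\<close> the element that leaves can always be taken from what remains of
  \<open>T\<close> and not from the earlier \<open>y i\<close>.\<close>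

lemma alg_cl_steinitz:
  fixes T :: "'a::field set" and n :: nat
  assumes "finite T" "\<And>i. i < n \<Longrightarrow> y i \<in> alg_cl T"
    and indep: "\<And>i. i < n \<Longrightarrow> y i \<notin> alg_cl (y ` {..<i})"
  shows "n \<le> card T"
proof -
  have "\<exists>T'. finite T' \<and> card T' + k = card T \<and> T \<subseteq> alg_cl (y ` {..<k} \<union> T')" if "k \<le> n" for k
    using that
  proof (induction k)
    case 0
    then show ?case using assms(1) alg_cl_incl by (intro exI[of _ T]) auto
  next
    case (Suc k)
    then obtain T' where T': "finite T'" "card T' + k = card T" "T \<subseteq> alg_cl (y ` {..<k} \<union> T')"
      by auto
    have "y k \<in> alg_cl (y ` {..<k} \<union> T')"
      using assms(2)[of k] alg_cl_least[OF T'(3)] Suc.prems by auto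
    then obtain t where t: "t \<in> T'" "t \<in> alg_cl (insert (y k) (y ` {..<k} \<union> (T' - {t})))"
      using alg_cl_steinitz_step[OF T'(1)] indep[of k] Suc.prems by auto
    have "insert (y k) (y ` {..<k} \<union> (T' - {t})) = y ` {..<Suc k} \<union> (T' - {t})"
      by (auto simp: lessThan_Suc)
    then have "y ` {..<k} \<union> T' \<subseteq> alg_cl (y ` {..<Suc k} \<union> (T' - {t}))"
      using t(2) alg_cl_incl[of "y ` {..<Suc k} \<union> (T' - {t})"] by (auto simp: lessThan_Suc)
    then have "T \<subseteq> alg_cl (y ` {..<Suc k} \<union> (T' - {t}))"
      using T'(3) alg_cl_least by blast
    moreover have "card (T' - {t}) + Suc k = card T"
      using T' t(1) card_gt_0_iff[of T'] by (auto simp: card_Diff_singleton)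
    ultimately show ?case using T'(1) by (intro exI[of _ "T' - {t}"]) auto
  qed
  from this[of n] show ?thesis by auto
qed

lemma alg_cl_independent_subfamily:
  fixes z :: "'i \<Rightarrow> 'a::field" and n :: nat
  assumes "finite I" "\<And>i. i < n \<Longrightarrow> y i \<in> alg_cl (z ` I)"
    and "\<And>i. i < n \<Longrightarrow> y i \<notin> alg_cl (y ` {..<i})"
  obtains \<sigma> where "inj_on \<sigma> {..<n}" "\<sigma> ` {..<n} \<subseteq> I"
    "\<And>k. k < n \<Longrightarrow> z (\<sigma> k) \<notin> alg_cl (z ` \<sigma> ` {..<k})"
proof -
  define P where "P = (\<lambda>J. J \<subseteq> I \<and> z ` I \<subseteq> alg_cl (z ` J))"
  have "P I" using alg_cl_incl[of "z ` I"] by (simp add: P_def)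
  obtain J where J: "P J" "\<And>J'. P J' \<Longrightarrow> card J \<le> card J'"
    using ex_has_least_nat[of P I card] \<open>P I\<close> by metis
  have fin: "finite J" using J(1) assms(1) finite_subset by (auto simp: P_def)
  have indep: "z j \<notin> alg_cl (z ` (J - {j}))" if "j \<in> J" for j
  proof
    assume *: "z j \<in> alg_cl (z ` (J - {j}))"
    then have "z ` J \<subseteq> alg_cl (z ` (J - {j}))"
      using alg_cl_incl[of "z ` (J - {j})"] by blast
    then have "P (J - {j})"
      using J(1) alg_cl_least[of "z ` J" "z ` (J - {j})"] by (auto simp: P_def)
    then show False
      using J(2) card_Diff1_less[OF fin that] by fastforce
  qed
  have "n \<le> card (z ` J)"
  proof (rule alg_cl_steinitz)
    show "y i \<in> alg_cl (z ` J)" if "i < n" for i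
      using assms(2)[OF that] J(1) alg_cl_least by (auto simp: P_def)
  qed (use fin assms in auto)
  also have "\<dots> \<le> card J" by (rule card_image_le[OF fin])
  finally obtain J' where J': "J' \<subseteq> J" "card J' = n"
    using obtain_subset_with_card_n by metis
  then obtain \<sigma> where \<sigma>: "bij_betw \<sigma> {..<n} J'"
    using finite_same_card_bij[of "{..<n}" J'] finite_subset[OF J'(1) fin] by auto
  show thesis
  proof
    show inj: "inj_on \<sigma> {..<n}" using \<sigma> by (simp add: bij_betw_def)
    have im: "\<sigma> ` {..<n} \<subseteq> J" using \<sigma> J' by (auto simp: bij_betw_def)
    then show "\<sigma> ` {..<n} \<subseteq> I" using J(1) by (auto simp: P_def)
    fix k assume "k < n"
    then have "\<sigma> ` {..<k} \<subseteq> J - {\<sigma> k}"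
      using im inj by (auto simp: inj_on_def)
    then show "z (\<sigma> k) \<notin> alg_cl (z ` \<sigma> ` {..<k})"
      using indep[of "\<sigma> k"] im \<open>k < n\<close> alg_cl_mono[of "z ` \<sigma> ` {..<k}" "z ` (J - {\<sigma> k})"] by blast
  qed
qed

section \<open>Unique factorization in subrings\<close>

text \<open>The relation \<open>dvd\<close> would admit cofactors from the whole type and says next
  to nothing in a field.\<close>

definition dvd_in :: "'a::comm_ring_1 set \<Rightarrow> 'a \<Rightarrow> 'a \<Rightarrow> bool" where
  "dvd_in R a b \<longleftrightarrow> (\<exists>c\<in>R. b = a * c)"

definition prime_in :: "'a::comm_ring_1 set \<Rightarrow> 'a \<Rightarrow> bool" where
  "prime_in R p \<longleftrightarrow> p \<in> R \<and> p \<noteq> 0 \<and> \<not> dvd_in R p 1 \<and>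
     (\<forall>a\<in>R. \<forall>b\<in>R. dvd_in R p (a * b) \<longrightarrow> dvd_in R p a \<or> dvd_in R p b)"

definition prime_factorization_in :: "'a::comm_ring_1 set \<Rightarrow> 'a \<Rightarrow> 'a \<Rightarrow> 'a list \<Rightarrow> bool" where
  "prime_factorization_in R a u ps \<longleftrightarrow>
     u \<in> R \<and> dvd_in R u 1 \<and> (\<forall>p\<in>set ps. prime_in R p) \<and> a = u * prod_list ps"

text \<open>The factors are prime and not just irreducible, so the existence of factorizations
  already implies their uniqueness and characterizes factorial domains.\<close>

locale factorial_subring = subring_set R for R :: "'a::idom set" +
  assumes factorization: "a \<in> R \<Longrightarrow> a \<noteq> 0 \<Longrightarrow> \<exists>u ps. prime_factorization_in R a u ps"

lemma dvd_inI: "c \<in> R \<Longrightarrow> b = a * c \<Longrightarrow> dvd_in R a b"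
  by (auto simp: dvd_in_def)

context subring_set
begin

lemma dvd_in_mult_right: "dvd_in R a b \<Longrightarrow> c \<in> R \<Longrightarrow> dvd_in R a (b * c)"
  by (auto simp: dvd_in_def mult.assoc intro: mult_mem)

lemma dvd_in_mult_left: "dvd_in R a b \<Longrightarrow> c \<in> R \<Longrightarrow> dvd_in R a (c * b)"
  using dvd_in_mult_right by (simp add: mult.commute)

lemma dvd_in_trans: "dvd_in R a b \<Longrightarrow> dvd_in R b c \<Longrightarrow> dvd_in R a c"
  by (auto simp: dvd_in_def mult.assoc intro: mult_mem)

lemma dvd_in_diff: "dvd_in R a b \<Longrightarrow> dvd_in R a c \<Longrightarrow> dvd_in R a (b - c)"
  by (auto simp: dvd_in_def right_diff_distrib[symmetric] intro: diff_mem)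

lemma dvd_in_add: "dvd_in R a b \<Longrightarrow> dvd_in R a c \<Longrightarrow> dvd_in R a (b + c)"
  by (auto simp: dvd_in_def distrib_left[symmetric] intro: add_mem)

lemma dvd_in_zero: "dvd_in R a 0"
  by (auto simp: dvd_in_def intro: bexI[of _ 0] zero_mem)

lemma dvd_in_refl: "dvd_in R a a"
  by (auto simp: dvd_in_def intro: bexI[of _ 1] one_mem)

lemma dvd_in_sum: "(\<And>i. i \<in> I \<Longrightarrow> dvd_in R a (f i)) \<Longrightarrow> dvd_in R a (sum f I)"
  by (induction I rule: infinite_finite_induct) (auto intro: dvd_in_add dvd_in_zero)

lemma prime_in_dvd_prod_list:
  assumes "prime_in R p" "set ps \<subseteq> R" "dvd_in R p (prod_list ps)"
  shows "\<exists>q\<in>set ps. dvd_in R p q"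
  using assms(2,3)
proof (induction ps)
  case Nil
  then show ?case using assms(1) by (simp add: prime_in_def)
next
  case (Cons q ps)
  have "prod_list ps \<in> R"
    using Cons.prems(1) by (induction ps) (auto intro: one_mem mult_mem)
  then show ?case using Cons assms(1) by (auto simp: prime_in_def)
qed

end

lemma poly_dvd_const_iff:
  fixes R :: "'a::idom set"
  assumes "subring_set R" "p \<noteq> 0"
  shows "dvd_in (polys_over R) [:p:] f \<longleftrightarrow> (\<forall>i. dvd_in R p (coeff f i))"
proof
  assume "dvd_in (polys_over R) [:p:] f"
  then show "\<forall>i. dvd_in R p (coeff f i)"
    by (auto simp: dvd_in_def polys_over_def)
next
  interpret subring_set R by fact
  assume "\<forall>i. dvd_in R p (coeff f i)"
  then obtain d where d: "\<And>i. d i \<in> R" "\<And>i. coeff f i = p * d i"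
    unfolding dvd_in_def by metis
  let ?g = "\<Sum>i\<le>degree f. monom (d i) i"
  have "?g \<in> polys_over R"
    by (intro polys_sum_mem monom_polys_over d)
  moreover have "f = [:p:] * ?g"
  proof (rule poly_eqI)
    fix n
    have "coeff ?g n = (if n \<le> degree f then d n else 0)" by (simp add: coeff_sum)
    then show "coeff f n = coeff ([:p:] * ?g) n" using d(2)[of n] by (auto simp: coeff_eq_0)
  qed
  ultimately show "dvd_in (polys_over R) [:p:] f"
    by (auto simp: dvd_in_def simp del: mult_pCons_left)
qed

text \<open>The classical argument for Gauss' lemma: if \<open>p\<close> divides neither polynomial,
  take in each the first coefficient that \<open>p\<close> does not divide, and look at the
  coefficient of the product at the sum of the two indices.\<close>

lemma prime_in_const:
  fixes R :: "'a::idom set"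
  assumes "subring_set R" "prime_in R p"
  shows "prime_in (polys_over R) [:p:]"
proof -
  interpret subring_set R by fact
  have p: "p \<in> R" "p \<noteq> 0" "\<not> dvd_in R p 1" using assms(2) by (auto simp: prime_in_def)
  note dvd_iff = poly_dvd_const_iff[OF assms(1) p(2)]
  have "dvd_in (polys_over R) [:p:] f \<or> dvd_in (polys_over R) [:p:] g"
    if f: "f \<in> polys_over R" and g: "g \<in> polys_over R"
      and fg: "dvd_in (polys_over R) [:p:] (f * g)" for f g
  proof (rule ccontr)
    assume "\<not> ?thesis"
    then have ex: "\<exists>i. \<not> dvd_in R p (coeff f i)" "\<exists>j. \<not> dvd_in R p (coeff g j)"
      by (auto simp: dvd_iff)
    obtain i where i: "\<not> dvd_in R p (coeff f i)" "\<And>k. k < i \<Longrightarrow> dvd_in R p (coeff f k)"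
      using exists_least_iff[THEN iffD1, OF ex(1)] by blast
    obtain j where j: "\<not> dvd_in R p (coeff g j)" "\<And>k. k < j \<Longrightarrow> dvd_in R p (coeff g k)"
      using exists_least_iff[THEN iffD1, OF ex(2)] by blast
    \<comment> \<open>The other terms of this coefficient: in each of them one index lies below
      \<open>i\<close> or the other below \<open>j\<close>, so \<open>p\<close> divides it.\<close>
    define s where "s = (\<Sum>k\<in>{..i + j} - {i}. coeff f k * coeff g (i + j - k))"
    have fg_coeff: "coeff (f * g) (i + j) = coeff f i * coeff g j + s"
      by (simp add: coeff_mult sum.remove[of "{..i + j}" i] s_def)
    have "dvd_in R p s"
      unfolding s_def
    proof (intro dvd_in_sum)
      fix k assume k: "k \<in> {..i + j} - {i}"
      show "dvd_in R p (coeff f k * coeff g (i + j - k))"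
      proof (cases "k < i")
        case True
        then show ?thesis
          using i(2) g by (intro dvd_in_mult_right) (auto simp: polys_over_coeff)
      next
        case False
        then have "i + j - k < j" using k by auto
        then show ?thesis
          using j(2) f by (intro dvd_in_mult_left) (auto simp: polys_over_coeff)
      qed
    qed
    then have "dvd_in R p (coeff (f * g) (i + j) - s)"
      using fg by (intro dvd_in_diff) (auto simp only: dvd_iff)
    then have "dvd_in R p (coeff f i * coeff g j)" by (simp add: fg_coeff)
    then show False
      using assms(2) i(1) j(1) polys_over_coeff[OF f] polys_over_coeff[OF g]
      unfolding prime_in_def by blast
  qed
  moreover have "\<not> dvd_in (polys_over R) [:p:] 1"
    using p(3) by (auto simp: dvd_iff)
  ultimately show ?thesis
    using p by (auto simp: prime_in_def const_polys_over simp del: mult_pCons_left)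
qed

text \<open>Long division in which every step first multiplies the dividend by the leading
  coefficient of \<open>g\<close>, so that nothing has to be divided by it; \<open>c\<close>
  collects these factors.\<close>

lemma pseudo_division_polys_over:
  fixes R :: "'a::idom set"
  assumes "subring_set R" and g: "g \<in> polys_over R" "g \<noteq> 0" and f: "f \<in> polys_over R"
  shows "\<exists>c\<in>R. c \<noteq> 0 \<and> (\<exists>q\<in>polys_over R. \<exists>r\<in>polys_over R.
           smult c f = g * q + r \<and> (r = 0 \<or> degree r < degree g))"
  using f
proof (induction "degree f" arbitrary: f rule: less_induct)
  case less
  interpret subring_set R by fact
  show ?case
  proof (cases "f = 0 \<or> degree f < degree g")
    case True
    then have "smult 1 f = g * 0 + f \<and> (f = 0 \<or> degree f < degree g)" by simp
    then show ?thesis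
      using less.prems one_mem polys_zero_mem one_neq_zero by blast
  next
    case False
    define b where "b = lead_coeff g"
    define s where "s = monom (lead_coeff f) (degree f - degree g)"
    define f' where "f' = smult b f - s * g"
    have b: "b \<in> R" "b \<noteq> 0" using g by (auto simp: b_def polys_over_coeff)
    have s: "s \<in> polys_over R"
      using less.prems by (auto simp: s_def monom_polys_over polys_over_coeff)
    have f': "f' \<in> polys_over R"
      unfolding f'_def using b s g less.prems
      by (intro polys_diff_mem smult_polys_over polys_mult_mem)
    have "degree (s * g) \<le> degree f"
      using degree_mult_le[of s g] degree_monom_le[of "lead_coeff f" "degree f - degree g"] False
      unfolding s_def by linarith
    then have le: "degree f' \<le> degree f"
      unfolding f'_def by (intro degree_diff_le) auto
    have "coeff (s * g) (degree f) = lead_coeff f * b"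
      using False by (simp add: s_def b_def coeff_monom_mult)
    then have "coeff f' (degree f) = 0" by (simp add: f'_def mult.commute)
    then have "f' = 0 \<or> degree f' < degree f"
      using le by (metis leading_coeff_0_iff le_neq_implies_less)
    then obtain c q r where *: "c \<in> R" "c \<noteq> 0" "q \<in> polys_over R" "r \<in> polys_over R"
      "smult c f' = g * q + r" "r = 0 \<or> degree r < degree g"
    proof
      assume "f' = 0"
      then show thesis by (intro that[of 1 0 0]) (auto intro: one_mem polys_zero_mem)
    next
      assume "degree f' < degree f"
      then show thesis using less.hyps[OF _ f'] that by blast
    qed
    have "smult (c * b) f = g * (q + smult c s) + r"
      using *(5) by (simp add: f'_def smult_diff_right algebra_simps)
    moreover have "q + smult c s \<in> polys_over R"
      using * s by (intro polys_add_mem smult_polys_over)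
    ultimately show ?thesis
      using * b by (intro bexI[of _ "c * b"] conjI bexI[of _ "q + smult c s"] bexI[of _ r])
        (auto intro: mult_mem)
  qed
qed

section \<open>Gauss' lemma and the factoriality of polynomial rings\<close>

context factorial_subring
begin

text \<open>For a nonzero polynomial over \<open>R\<close> this is the usual condition that the
  content is a unit, stated without a gcd of the coefficients.\<close>

definition primitive :: "'a poly \<Rightarrow> bool" where
  "primitive g \<longleftrightarrow> (\<forall>p. prime_in R p \<longrightarrow> \<not> dvd_in (polys_over R) [:p:] g)"

text \<open>The prime factors of \<open>c\<close> are cancelled one at a time: a prime constant
  \<open>p\<close> stays prime among the polynomials, so if it divides \<open>g\<close> times a
  cofactor without dividing \<open>g\<close>, it divides the cofactor.\<close>

lemma primitive_dvd_smult:
  assumes "primitive g" "g \<in> polys_over R" "c \<in> R" "c \<noteq> 0" "a \<in> polys_over R"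
    and "dvd_in (polys_over R) g (smult c a)"
  shows "dvd_in (polys_over R) g a"
proof -
  have *: "dvd_in (polys_over R) g a"
    if "u \<in> R" "dvd_in R u 1" "\<forall>p\<in>set ps. prime_in R p" "a \<in> polys_over R"
      "dvd_in (polys_over R) g (smult (u * prod_list ps) a)" for u ps a
    using that
  proof (induction ps arbitrary: a)
    case Nil
    then obtain v where v: "v \<in> R" "1 = u * v" by (auto simp: dvd_in_def)
    then have "a = smult u a * [:v:]" by (simp add: mult.commute)
    then show ?case
      using Nil.prems(5) subring_set.dvd_in_mult_right[OF polys_over_subring _ const_polys_over[OF v(1)]]
      by (metis mult.right_neutral prod_list.Nil)
  next
    case (Cons p ps)
    have p: "prime_in (polys_over R) [:p:]" "p \<in> R" "p \<noteq> 0"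
      using Cons.prems prime_in_const[OF subring_set_axioms] by (auto simp: prime_in_def)
    have "smult (u * prod_list (p # ps)) a = smult (u * prod_list ps) (smult p a)"
      by (simp add: mult_ac)
    then have "dvd_in (polys_over R) g (smult p a)"
      using Cons p(2) smult_polys_over by (metis list.set_intros(2))
    then obtain q where q: "q \<in> polys_over R" "[:p:] * a = g * q"
      by (auto simp: dvd_in_def)
    then have "dvd_in (polys_over R) [:p:] (g * q)"
      using dvd_inI[OF Cons.prems(4)] by metis
    then have "dvd_in (polys_over R) [:p:] q"
      using p(1) q(1) assms(1,2) Cons.prems(3) by (auto simp: prime_in_def primitive_def)
    then obtain q' where q': "q' \<in> polys_over R" "q = [:p:] * q'" by (auto simp: dvd_in_def)
    then have "[:p:] * a = [:p:] * (g * q')"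
      using q(2) by (simp add: mult_ac)
    then have "a = g * q'" using p(3) by (metis mult_left_cancel pCons_eq_0_iff)
    then show ?case using q' by (auto simp: dvd_in_def)
  qed
  obtain u ps where "prime_factorization_in R c u ps"
    using factorization assms by blast
  then show ?thesis using *[of u ps a] assms by (auto simp: prime_factorization_in_def)
qed

text \<open>Provides the decreasing measure for \<open>primitive_part\<close>: splitting off a prime
  shortens the factorization. The prime \<open>p\<close> divides some \<open>q\<close> in the list
  and turns out to be associated to it, and \<open>q\<close> is removed.\<close>

lemma prime_cofactor:
  assumes "prime_in R p" "b \<in> R" "prime_factorization_in R (p * b) u ps"
  shows "\<exists>v qs. prime_factorization_in R b v qs \<and> length qs < length ps"
proof -
  have p: "p \<in> R" "p \<noteq> 0" "\<not> dvd_in R p 1" using assms(1) by (auto simp: prime_in_def)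
  have u: "u \<in> R" "dvd_in R u 1" and ps: "\<forall>p\<in>set ps. prime_in R p" and eq: "p * b = u * prod_list ps"
    using assms(3) by (auto simp: prime_factorization_in_def)
  have psR: "set ps \<subseteq> R" using ps by (auto simp: prime_in_def)
  then have "prod_list ps \<in> R" by (induction ps) (auto intro: one_mem mult_mem)
  moreover have "\<not> dvd_in R p u" using u(2) p(3) dvd_in_trans by blast
  moreover have "dvd_in R p (u * prod_list ps)" using dvd_inI[OF assms(2)] eq by metis
  ultimately have "dvd_in R p (prod_list ps)"
    using assms(1) u(1) by (auto simp: prime_in_def)
  then obtain q where q: "q \<in> set ps" "dvd_in R p q"
    using prime_in_dvd_prod_list[OF assms(1) psR] by blast
  then obtain r where r: "r \<in> R" "q = p * r" by (auto simp: dvd_in_def)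
  have pq: "prime_in R q" "q \<noteq> 0" using ps q by (auto simp: prime_in_def)
  \<comment> \<open>As \<open>p\<close> is not a unit, \<open>q\<close> cannot divide
    \<open>r\<close>, so it divides \<open>p\<close>. Then \<open>r\<close> is a unit with inverse
    \<open>t\<close> and is absorbed into the unit of the new factorization.\<close>
  have "\<not> dvd_in R q r"
  proof
    assume "dvd_in R q r"
    then obtain s where "s \<in> R" "r = q * s" by (auto simp: dvd_in_def)
    then have "q * (p * s) = q * 1" using r(2) by (simp add: mult_ac)
    then have "p * s = 1" using pq(2) by (metis mult_left_cancel)
    then show False using p(3) \<open>s \<in> R\<close> by (auto simp: dvd_in_def)
  qed
  moreover have "dvd_in R q (p * r)" using r dvd_in_refl by simp
  ultimately have "dvd_in R q p" using pq(1) p(1) r(1) by (auto simp: prime_in_def)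
  then obtain t where t: "t \<in> R" "p = q * t" by (auto simp: dvd_in_def)
  then have "q * (t * r) = q * 1" using r(2) by (metis mult.assoc mult.right_neutral)
  then have tr: "t * r = 1" using pq(2) by (metis mult_left_cancel)
  obtain xs ys where xy: "ps = xs @ q # ys" using split_list[OF q(1)] by blast
  have "p * b = p * (r * u * prod_list (xs @ ys))"
    using eq r(2) by (simp add: xy mult_ac)
  then have "b = r * u * prod_list (xs @ ys)" using p(2) by (metis mult_left_cancel)
  moreover have "dvd_in R (r * u) 1"
  proof -
    obtain w where w: "w \<in> R" "1 = u * w" using u(2) by (auto simp: dvd_in_def)
    have "(r * u) * (t * w) = (t * r) * (u * w)" by (simp add: mult_ac)
    then have "1 = (r * u) * (t * w)" using tr w by simp
    then show ?thesis using w t by (auto simp: dvd_in_def intro: mult_mem)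
  qed
  ultimately have "prime_factorization_in R b (r * u) (xs @ ys)"
    using u r ps by (auto simp: prime_factorization_in_def xy intro: mult_mem)
  then show ?thesis using xy by (intro exI[of _ "r * u"] exI[of _ "xs @ ys"]) auto
qed

text \<open>Prime constants are split off as long as one divides \<open>f\<close>. This ends because
  each of them shortens the factorization of the leading coefficient.\<close>

lemma primitive_part:
  assumes "f \<in> polys_over R" "f \<noteq> 0"
  shows "\<exists>c\<in>R. c \<noteq> 0 \<and> (\<exists>g\<in>polys_over R. primitive g \<and> f = smult c g)"
proof -
  have "\<exists>c\<in>R. c \<noteq> 0 \<and> (\<exists>g\<in>polys_over R. primitive g \<and> f = smult c g)"
    if "f \<in> polys_over R" "f \<noteq> 0" "prime_factorization_in R (lead_coeff f) u ps" for f u ps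
    using that
  proof (induction "length ps" arbitrary: f u ps rule: less_induct)
    case less
    show ?case
    proof (cases "primitive f")
      case True
      then show ?thesis
        using less.prems by (auto intro!: bexI[of _ 1] bexI[of _ f] one_mem)
    next
      case False
      then obtain p f' where p: "prime_in R p" "f' \<in> polys_over R" "f = smult p f'"
        by (auto simp: primitive_def dvd_in_def)
      then have "lead_coeff f = p * lead_coeff f'" by simp
      then obtain v qs where "prime_factorization_in R (lead_coeff f') v qs" "length qs < length ps"
        using prime_cofactor[OF p(1) polys_over_coeff[OF p(2)]] less.prems(3) by metis
      moreover have "f' \<noteq> 0" using p less.prems by auto
      ultimately obtain c g where "c \<in> R" "c \<noteq> 0" "g \<in> polys_over R" "primitive g" "f' = smult c g"
        using less.hyps[of qs f' v] p(2) by blast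
      then show ?thesis
        using p by (auto simp: prime_in_def intro!: bexI[of _ "p * c"] bexI[of _ g] mult_mem)
    qed
  qed
  moreover obtain u ps where "prime_factorization_in R (lead_coeff f) u ps"
    using factorization[OF polys_over_coeff[OF assms(1)]] assms(2) by (meson leading_coeff_0_iff)
  ultimately show ?thesis using assms by blast
qed

text \<open>A divisor of \<open>f\<close> over the field of fractions, of least positive degree and made primitive,
  is prime: by Bezout over the field of fractions it is prime there, and primitivity allows one to
  cancel the constants.\<close>

lemma prime_polynomial_divisor:
  assumes f: "f \<in> polys_over R" "degree f > 0"
  shows "\<exists>g. prime_in (polys_over R) g \<and> degree g > 0 \<and> dvd_in (polys_over R) g f"
proof -
  interpret P: subring_set "polys_over R" by (rule polys_over_subring)
  define D where "D = (\<lambda>g. g \<in> polys_over R \<and> degree g > 0 \<and>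
    (\<exists>c\<in>R. c \<noteq> 0 \<and> dvd_in (polys_over R) g (smult c f)))"
  have "D f" using f by (auto simp: D_def intro!: bexI[of _ 1] one_mem P.dvd_in_refl)
  then obtain g0 where g0: "D g0" "\<And>g. D g \<Longrightarrow> degree g0 \<le> degree g"
    using ex_has_least_nat[of D f degree] by metis
  then obtain e g where e: "e \<in> R" "e \<noteq> 0" and g: "g \<in> polys_over R" "primitive g" "g0 = smult e g"
    using primitive_part[of g0] by (force simp: D_def)
  have "D g"
  proof -
    obtain c h where "c \<in> R" "c \<noteq> 0" "h \<in> polys_over R" "smult c f = g0 * h"
      using g0(1) by (auto simp: D_def dvd_in_def)
    then show ?thesis
      using g0(1) g e by (auto simp: D_def dvd_in_def smult_polys_over
          intro!: bexI[of _ c] bexI[of _ "smult e h"])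
  qed
  have g_min: "degree g \<le> degree g'" if "D g'" for g'
    using g0(2)[OF that] g e by simp
  obtain cf where cf: "cf \<in> R" "cf \<noteq> 0" "dvd_in (polys_over R) g (smult cf f)"
    and deg_g: "degree g > 0" using \<open>D g\<close> by (auto simp: D_def)
  have "g \<noteq> 0" using deg_g by auto
  have "dvd_in (polys_over R) g a \<or> dvd_in (polys_over R) g b"
    if a: "a \<in> polys_over R" and b: "b \<in> polys_over R" and ab: "dvd_in (polys_over R) g (a * b)" for a b
  proof -
    \<comment> \<open>The ideal generated by \<open>g\<close> and \<open>a\<close>. A nonzero
      element \<open>d\<close> of least degree is their greatest common divisor over the field of
      fractions.\<close>
    define S where "S = (\<lambda>d. \<exists>u\<in>polys_over R. \<exists>v\<in>polys_over R. d = u * g + v * a)"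
    have S_P: "d \<in> polys_over R" if "S d" for d
      using that a g by (auto simp: S_def intro!: P.add_mem P.mult_mem)
    have S_smult: "S (smult c d)" if "S d" "c \<in> R" for c d
      using that by (auto simp: S_def smult_add_right smult_polys_over
          intro!: bexI[of _ "smult c _"] simp flip: mult_smult_left)
    have S_diff: "S (d - d' * q)" if "S d" "S d'" "q \<in> polys_over R" for d d' q
    proof -
      obtain u v u' v' where "u \<in> polys_over R" "v \<in> polys_over R" "u' \<in> polys_over R" "v' \<in> polys_over R"
        "d = u * g + v * a" "d' = u' * g + v' * a"
        using \<open>S d\<close> \<open>S d'\<close> by (auto simp: S_def)
      then show ?thesis
        using that(3) unfolding S_def
        by (intro bexI[of _ "u - u' * q"] bexI[of _ "v - v' * q"] P.diff_mem P.mult_mem)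
           (auto simp: algebra_simps)
    qed
    have "S g" "S a"
      unfolding S_def
      by (rule bexI[of _ 1], rule bexI[of _ 0])
         (auto intro: P.one_mem P.zero_mem,
           rule bexI[of _ 0], rule bexI[of _ 1], auto intro: P.one_mem P.zero_mem)
    then obtain d where d: "S d" "d \<noteq> 0" "\<And>d'. S d' \<Longrightarrow> d' \<noteq> 0 \<Longrightarrow> degree d \<le> degree d'"
      using ex_has_least_nat[of "\<lambda>d. S d \<and> d \<noteq> 0" g degree] \<open>g \<noteq> 0\<close> by metis
    have d_div: "\<exists>c\<in>R. c \<noteq> 0 \<and> dvd_in (polys_over R) d (smult c s)" if s: "S s" for s
    proof -
      obtain c q r where *: "c \<in> R" "c \<noteq> 0" "q \<in> polys_over R" "r \<in> polys_over R"
        "smult c s = d * q + r" "r = 0 \<or> degree r < degree d"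
        using pseudo_division_polys_over[OF subring_set_axioms S_P[OF d(1)] d(2) S_P[OF s]] by blast
      have "r = smult c s - d * q" using *(5) by simp
      then have "S r" using S_diff[OF S_smult[OF s *(1)] d(1) *(3)] by simp
      then have "r = 0" using d(3)[of r] *(6) by force
      then show ?thesis using * by (auto simp: dvd_in_def)
    qed
    obtain c q where c: "c \<in> R" "c \<noteq> 0" "q \<in> polys_over R" "smult c g = d * q"
      using d_div[OF \<open>S g\<close>] by (auto simp: dvd_in_def)
    obtain c' q' where c': "c' \<in> R" "c' \<noteq> 0" "q' \<in> polys_over R" "smult c' a = d * q'"
      using d_div[OF \<open>S a\<close>] by (auto simp: dvd_in_def)
    show ?thesis
    proof (cases "degree d = 0")
      \<comment> \<open>Here \<open>d\<close> is a nonzero constant \<open>k\<close>. Multiplying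
        the Bezout identity by \<open>b\<close> shows that \<open>g\<close> divides
        \<open>smult k b\<close>, and primitivity removes \<open>k\<close>.\<close>
      case True
      then obtain k where k: "d = [:k:]" by (metis degree_eq_zeroE)
      then have "k \<noteq> 0" "k \<in> R"
        using d(2) polys_over_coeff[OF S_P[OF d(1)], of 0] by auto
      obtain u v where uv: "u \<in> polys_over R" "v \<in> polys_over R" "d = u * g + v * a"
        using d(1) by (auto simp: S_def)
      have "smult k b = g * (u * b) + v * (a * b)"
        using arg_cong[OF uv(3), of "\<lambda>x. x * b"] by (simp add: k algebra_simps)
      moreover have "dvd_in (polys_over R) g (g * (u * b) + v * (a * b))"
        using uv b ab by (intro P.dvd_in_add P.dvd_in_mult_left[OF ab]
            P.dvd_in_mult_right[OF P.dvd_in_refl] P.mult_mem)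
      ultimately have "dvd_in (polys_over R) g (smult k b)" by simp
      then show ?thesis
        using primitive_dvd_smult[OF g(2,1) \<open>k \<in> R\<close> \<open>k \<noteq> 0\<close> b] by simp
    next
      \<comment> \<open>Here \<open>d\<close> divides a multiple of \<open>g\<close> and hence one
        of \<open>f\<close>, so the minimality of \<open>degree g\<close> forces the quotient
        \<open>q\<close> to be constant. Thus \<open>g\<close> and \<open>d\<close> agree up to
        constants, and \<open>g\<close> divides a multiple of \<open>a\<close> because
        \<open>d\<close> does.\<close>
      case False
      obtain h where h: "h \<in> polys_over R" "smult cf f = g * h" using cf(3) by (auto simp: dvd_in_def)
      have "smult (cf * c) f = d * (q * h)"
      proof -
        have "smult (cf * c) f = smult c (smult cf f)" by (simp add: mult.commute)
        also have "\<dots> = smult c g * h" by (simp add: h)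
        finally show ?thesis by (simp add: c mult.assoc)
      qed
      then have "D d"
        using False S_P[OF d(1)] cf c h
        by (auto simp: D_def dvd_in_def intro!: bexI[of _ "cf * c"] bexI[of _ "q * h"] mult_mem P.mult_mem)
      then have "degree g \<le> degree d" by (rule g_min)
      moreover have "q \<noteq> 0" using c \<open>g \<noteq> 0\<close> by auto
      moreover have "degree g = degree d + degree q"
        using arg_cong[OF c(4), of degree] c(2) d(2) \<open>q \<noteq> 0\<close> by (simp add: degree_mult_eq)
      ultimately obtain k where k: "q = [:k:]" "k \<noteq> 0"
        by (metis add_cancel_right_right degree_eq_zeroE le_antisym le_add1 pCons_0_0)
      then have "k \<in> R" using polys_over_coeff[OF c(3), of 0] by simp
      have "smult (k * c') a = (d * q) * q'"
        using arg_cong[OF c'(4), of "smult k"] by (simp add: k)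
      also have "\<dots> = g * smult c q'" by (simp flip: c(4))
      finally have "dvd_in (polys_over R) g (smult (k * c') a)"
        using c c' by (auto simp: dvd_in_def intro!: bexI[of _ "smult c q'"] smult_polys_over)
      then show ?thesis
        using primitive_dvd_smult[OF g(2,1) mult_mem[OF \<open>k \<in> R\<close> c'(1)] _ a] k c' by simp
    qed
  qed
  moreover have "\<not> dvd_in (polys_over R) g 1"
  proof
    assume "dvd_in (polys_over R) g 1"
    then have "g dvd 1" by (metis dvd_in_def dvdI)
    then show False using dvd_imp_degree_le[of g 1] deg_g by simp
  qed
  ultimately have "prime_in (polys_over R) g"
    using g \<open>g \<noteq> 0\<close> by (auto simp: prime_in_def)
  moreover have "dvd_in (polys_over R) g f"
    using primitive_dvd_smult[OF g(2,1) cf(1,2) f(1) cf(3)] .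
  ultimately show ?thesis using deg_g by blast
qed

text \<open>Gauss' theorem, by induction on the degree: constants are factored in \<open>R\<close>,
  and from a polynomial of positive degree a prime divisor of positive degree is split off.\<close>

theorem polys_over_factorial: "factorial_subring (polys_over R)"
proof -
  interpret P: subring_set "polys_over R" by (rule polys_over_subring)
  have "\<exists>u ps. prime_factorization_in (polys_over R) f u ps" if "f \<in> polys_over R" "f \<noteq> 0" for f
    using that
  proof (induction "degree f" arbitrary: f rule: less_induct)
    case less
    show ?case
    proof (cases "degree f = 0")
      case True
      then obtain a where a: "f = [:a:]" by (metis degree_eq_zeroE)
      then have "a \<in> R" "a \<noteq> 0" using less.prems polys_over_coeff[of f R 0] by auto
      then obtain u ps where up: "prime_factorization_in R a u ps" using factorization by blast
      have "[:prod_list ps:] = prod_list (map (\<lambda>p. [:p:]) ps)"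
      proof (induction ps)
        case (Cons p ps)
        have "[:prod_list (p # ps):] = [:p:] * [:prod_list ps:]" by simp
        then show ?case using Cons by simp
      qed (simp add: one_pCons)
      moreover have unit: "dvd_in (polys_over R) [:u:] 1"
      proof -
        obtain v where "v \<in> R" "1 = u * v"
          using up by (auto simp: prime_factorization_in_def dvd_in_def)
        then show ?thesis
          by (intro dvd_inI[OF const_polys_over]) (simp_all add: one_pCons mult.commute)
      qed
      moreover have "[:u * prod_list ps:] = [:u:] * [:prod_list ps:]" by simp
      ultimately have "prime_factorization_in (polys_over R) f [:u:] (map (\<lambda>p. [:p:]) ps)"
        using up a prime_in_const[OF subring_set_axioms]
        by (auto simp: prime_factorization_in_def const_polys_over unit simp del: mult_pCons_left)
      then show ?thesis by blast
    next
      case False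
      then obtain g where g: "prime_in (polys_over R) g" "degree g > 0" "dvd_in (polys_over R) g f"
        using prime_polynomial_divisor less.prems by blast
      then obtain h where h: "h \<in> polys_over R" "f = g * h" by (auto simp: dvd_in_def)
      then have "h \<noteq> 0" "g \<noteq> 0" using less.prems by auto
      then have "degree h < degree f" using h g by (simp add: degree_mult_eq)
      then obtain u ps where "prime_factorization_in (polys_over R) h u ps"
        using less.hyps[OF _ h(1) \<open>h \<noteq> 0\<close>] by blast
      then have "prime_factorization_in (polys_over R) f u (g # ps)"
        using g h by (auto simp: prime_factorization_in_def mult_ac)
      then show ?thesis by blast
    qed
  qed
  then show ?thesis by unfold_locales
qed

text \<open>A monic minimal polynomial would in general have its coefficients in the field of
  fractions only, so a polynomial of least degree is made primitive instead. The remainder of a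
  pseudo-division by it vanishes by minimality, and primitivity cancels the constant introduced by
  the pseudo-division, so that the quotient stays over \<open>R\<close>.\<close>

lemma minimal_polynomial:
  assumes "algebraic_over R z"
  obtains m where "m \<in> polys_over R" "poly m z = 0"
    "\<And>f. f \<in> polys_over R \<Longrightarrow> poly f z = 0 \<Longrightarrow> dvd_in (polys_over R) m f"
proof -
  define D where "D = (\<lambda>m. m \<in> polys_over R \<and> m \<noteq> 0 \<and> poly m z = 0)"
  have "\<exists>m. D m" using assms by (auto simp: algebraic_over_def D_def)
  then obtain m0 where m0: "D m0" "\<And>m. D m \<Longrightarrow> degree m0 \<le> degree m"
    using ex_has_least_nat[of D _ degree] by metis
  then obtain c m where c: "c \<in> R" "c \<noteq> 0" and m: "m \<in> polys_over R" "primitive m" "m0 = smult c m"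
    using primitive_part[of m0] by (auto simp: D_def)
  have mz: "poly m z = 0" "m \<noteq> 0" using m0(1) m(3) c by (auto simp: D_def)
  show thesis
  proof (rule that[OF m(1) mz(1)])
    fix f assume f: "f \<in> polys_over R" "poly f z = 0"
    obtain b q r where *: "b \<in> R" "b \<noteq> 0" "q \<in> polys_over R" "r \<in> polys_over R"
      "smult b f = m * q + r" "r = 0 \<or> degree r < degree m"
      using pseudo_division_polys_over[OF subring_set_axioms m(1) mz(2) f(1)] by blast
    have "poly r z = 0" using arg_cong[OF *(5), of "\<lambda>p. poly p z"] f mz by simp
    then have "r = 0" using m0(2)[of r] *(4,6) m(3) c by (force simp: D_def)
    then have "dvd_in (polys_over R) m (smult b f)" using * by (auto simp: dvd_in_def)
    then show "dvd_in (polys_over R) m f"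
      by (rule primitive_dvd_smult[OF m(2,1) *(1,2) f(1)])
  qed
qed

end

text \<open>Factorizations are carried over by a map that is an injective homomorphism on
  \<open>R\<close>. The intended map is the evaluation of polynomials at a transcendental
  element.\<close>

lemma factorial_subring_image:
  fixes h :: "'a::idom \<Rightarrow> 'b::idom"
  assumes "factorial_subring R" "h 1 = 1"
    and diff: "\<And>a b. a \<in> R \<Longrightarrow> b \<in> R \<Longrightarrow> h (a - b) = h a - h b"
    and mult: "\<And>a b. a \<in> R \<Longrightarrow> b \<in> R \<Longrightarrow> h (a * b) = h a * h b"
    and inj: "\<And>a. a \<in> R \<Longrightarrow> h a = 0 \<Longrightarrow> a = 0"
  shows "factorial_subring (h ` R)"
proof -
  interpret factorial_subring R by fact
  have inj': "a = b" if "a \<in> R" "b \<in> R" "h a = h b" for a b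
    using inj[of "a - b"] diff_mem[OF that(1,2)] diff[OF that(1,2)] that(3) by simp
  have "h 0 = 0" using diff[OF one_mem one_mem] by simp
  have dvd_iff: "dvd_in (h ` R) (h a) (h b) \<longleftrightarrow> dvd_in R a b" if "a \<in> R" "b \<in> R" for a b
  proof
    assume "dvd_in (h ` R) (h a) (h b)"
    then obtain c where "c \<in> R" "h b = h a * h c" by (auto simp: dvd_in_def)
    then have c: "c \<in> R" "h b = h (a * c)" using that mult by auto
    then have "b = a * c" using that by (intro inj' mult_mem)
    then show "dvd_in R a b" using c by (intro dvd_inI)
  qed (use that mult in \<open>auto simp: dvd_in_def\<close>)
  have prime: "prime_in (h ` R) (h p)" if p: "prime_in R p" for p
  proof -
    have "dvd_in (h ` R) (h p) (h a) \<or> dvd_in (h ` R) (h p) (h b)"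
      if "a \<in> R" "b \<in> R" "dvd_in (h ` R) (h p) (h a * h b)" for a b
      using that p dvd_iff[of p "a * b"] dvd_iff[of p a] dvd_iff[of p b]
      by (auto simp: prime_in_def mult mult_mem)
    then show ?thesis
      using p inj[of p] dvd_iff[OF _ one_mem, of p] assms(2) by (auto simp: prime_in_def)
  qed
  have prod: "prod_list ps \<in> R \<and> h (prod_list ps) = prod_list (map h ps)" if "set ps \<subseteq> R" for ps
    using that by (induction ps) (auto simp: assms(2) one_mem mult_mem mult)
  show ?thesis
  proof
    show "1 \<in> h ` R" using assms(2) one_mem by (metis imageI)
    show "a - b \<in> h ` R" "a * b \<in> h ` R" if "a \<in> h ` R" "b \<in> h ` R" for a b
      using that by (auto simp flip: diff mult intro!: imageI diff_mem mult_mem)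
    fix a assume "a \<in> h ` R" "a \<noteq> 0"
    then obtain b where b: "b \<in> R" "a = h b" "b \<noteq> 0" using \<open>h 0 = 0\<close> by auto
    then obtain u ps where up: "prime_factorization_in R b u ps" using factorization by blast
    have u: "u \<in> R" "dvd_in R u 1" and ps: "\<forall>p\<in>set ps. prime_in R p" and eq: "b = u * prod_list ps"
      using up by (auto simp: prime_factorization_in_def)
    have "set ps \<subseteq> R" using ps by (auto simp: prime_in_def)
    then have "a = h u * prod_list (map h ps)"
      using prod[of ps] mult[OF u(1)] b(2) eq by simp
    moreover have "dvd_in (h ` R) (h u) 1" using dvd_iff[OF u(1) one_mem] u(2) assms(2) by simp
    ultimately have "prime_factorization_in (h ` R) a (h u) (map h ps)"
      using u ps prime by (auto simp: prime_factorization_in_def)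
    then show "\<exists>u ps. prime_factorization_in (h ` R) a u ps" by blast
  qed
qed

lemma factorial_subring_adjoin_transcendental:
  assumes "factorial_subring R" "\<not> algebraic_over R z"
  shows "factorial_subring ((\<lambda>p. poly p z) ` polys_over R)"
proof -
  interpret factorial_subring R by fact
  show ?thesis
    by (rule factorial_subring_image[OF polys_over_factorial])
       (use assms(2) in \<open>auto simp: algebraic_over_def\<close>)
qed

lemma factorial_subring_field:
  fixes K :: "'a::field set"
  assumes "subring_set K" "\<And>x. x \<in> K \<Longrightarrow> inverse x \<in> K"
  shows "factorial_subring K"
proof -
  interpret subring_set K by fact
  have "prime_factorization_in K a a []" if "a \<in> K" "a \<noteq> 0" for a
    using that assms(2)[of a] by (auto simp: prime_factorization_in_def dvd_in_def intro!: bexI[of _ "inverse a"])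
  then show ?thesis by unfold_locales blast
qed

section \<open>Algebraic independence\<close>

definition monom_eval :: "(nat \<Rightarrow> complex) \<Rightarrow> (nat \<Rightarrow>\<^sub>0 nat) \<Rightarrow> complex" where
  "monom_eval y m = (\<Prod>i\<in>Poly_Mapping.keys m. y i ^ Poly_Mapping.lookup m i)"

definition mpolys_over :: "complex set \<Rightarrow> nat \<Rightarrow> ((nat \<Rightarrow>\<^sub>0 nat) \<Rightarrow>\<^sub>0 complex) set" where
  "mpolys_over K n = {p. \<forall>m\<in>Poly_Mapping.keys p. Poly_Mapping.keys m \<subseteq> {..<n} \<and> Poly_Mapping.lookup p m \<in> K}"

lemma monom_eval_superset:
  assumes "finite I" "Poly_Mapping.keys m \<subseteq> I"
  shows "monom_eval y m = (\<Prod>i\<in>I. y i ^ Poly_Mapping.lookup m i)"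
  unfolding monom_eval_def
  by (rule prod.mono_neutral_left) (use assms in \<open>auto simp: in_keys_iff\<close>)

lemma monom_eval_add: "monom_eval y (m + m') = monom_eval y m * monom_eval y m'"
proof -
  let ?I = "Poly_Mapping.keys m \<union> Poly_Mapping.keys m'"
  have "Poly_Mapping.keys (m + m') \<subseteq> ?I" by (rule keys_add)
  then show ?thesis
    by (simp add: monom_eval_superset[of ?I] lookup_add power_add prod.distrib)
qed

lemma monom_eval_single: "monom_eval y (Poly_Mapping.single i k) = y i ^ k"
  by (simp add: monom_eval_def)

lemma monom_eval_zero: "monom_eval y 0 = 1"
  by (simp add: monom_eval_def)

lemma mpoly_eval_superset:
  assumes "finite S" "Poly_Mapping.keys p \<subseteq> S"
  shows "mpoly_eval y p = (\<Sum>m\<in>S. Poly_Mapping.lookup p m * monom_eval y m)"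
  unfolding mpoly_eval_def monom_eval_def
  by (rule sum.mono_neutral_left) (use assms in \<open>auto simp: in_keys_iff\<close>)

lemma mpoly_eval_zero: "mpoly_eval y 0 = 0"
  by (simp add: mpoly_eval_def)

lemma mpoly_eval_add: "mpoly_eval y (p + q) = mpoly_eval y p + mpoly_eval y q"
proof -
  let ?S = "Poly_Mapping.keys p \<union> Poly_Mapping.keys q"
  have "Poly_Mapping.keys (p + q) \<subseteq> ?S" by (rule keys_add)
  then show ?thesis
    by (simp add: mpoly_eval_superset[of ?S] lookup_add distrib_right sum.distrib)
qed

lemma mpoly_eval_uminus: "mpoly_eval y (- p) = - mpoly_eval y p"
  by (simp add: mpoly_eval_def sum_negf)

lemma mpoly_eval_sum: "mpoly_eval y (sum f I) = (\<Sum>i\<in>I. mpoly_eval y (f i))"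
  by (induction I rule: infinite_finite_induct) (simp_all add: mpoly_eval_zero mpoly_eval_add)

lemma mpoly_eval_single: "mpoly_eval y (Poly_Mapping.single m c) = c * monom_eval y m"
  by (simp add: mpoly_eval_superset[of "{m}"])

lemma mpolys_over_altdef:
  assumes "0 \<in> K"
  shows "p \<in> mpolys_over K n \<longleftrightarrow> (\<forall>m. Poly_Mapping.lookup p m \<in> K \<and>
     (Poly_Mapping.lookup p m \<noteq> 0 \<longrightarrow> Poly_Mapping.keys m \<subseteq> {..<n}))"
  using assms by (auto simp: mpolys_over_def in_keys_iff)

lemma mpolys_over_add:
  assumes "subring_set K" "p \<in> mpolys_over K n" "q \<in> mpolys_over K n"
  shows "p + q \<in> mpolys_over K n"
proof -
  interpret subring_set K by fact
  show ?thesis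
    using assms(2,3) unfolding mpolys_over_altdef[OF zero_mem] lookup_add
    by (metis add.left_neutral add_mem)
qed

lemma mpolys_over_sum:
  assumes "subring_set K" "\<And>i. i \<in> I \<Longrightarrow> f i \<in> mpolys_over K n"
  shows "sum f I \<in> mpolys_over K n"
proof -
  have "0 \<in> mpolys_over K n" by (simp add: mpolys_over_def)
  then show ?thesis
    using assms(2)
    by (induction I rule: infinite_finite_induct) (auto intro: mpolys_over_add[OF assms(1)])
qed

lemma mpolys_over_uminus:
  assumes "subring_set K" "p \<in> mpolys_over K n"
  shows "- p \<in> mpolys_over K n"
  using assms subring_set.uminus_mem[OF assms(1)] by (auto simp: mpolys_over_def)

lemma mpolys_over_single:
  assumes "c \<in> K" "Poly_Mapping.keys m \<subseteq> {..<n}"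
  shows "Poly_Mapping.single m c \<in> mpolys_over K n"
  using assms by (auto simp: mpolys_over_def lookup_single)

lemma mpoly_eval_image_subring:
  assumes "subring_set K"
  shows "subring_set (mpoly_eval y ` mpolys_over K n)"
proof
  interpret subring_set K by fact
  let ?M = "mpoly_eval y ` mpolys_over K n"
  show "1 \<in> ?M"
    by (rule image_eqI[OF _ mpolys_over_single[of 1 _ 0]])
       (simp_all add: one_mem mpoly_eval_single monom_eval_zero del: single_one)
  fix a b assume "a \<in> ?M" "b \<in> ?M"
  then obtain p q where p: "p \<in> mpolys_over K n" "a = mpoly_eval y p"
    and q: "q \<in> mpolys_over K n" "b = mpoly_eval y q" by auto
  have "a - b = mpoly_eval y (p + - q)"
    by (simp only: mpoly_eval_add mpoly_eval_uminus p q) simp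
  then show "a - b \<in> ?M"
    by (rule image_eqI) (intro mpolys_over_add mpolys_over_uminus p q assms)
  let ?r = "\<Sum>m\<in>Poly_Mapping.keys p. \<Sum>m'\<in>Poly_Mapping.keys q.
    Poly_Mapping.single (m + m') (Poly_Mapping.lookup p m * Poly_Mapping.lookup q m')"
  have "a * b = mpoly_eval y ?r"
    by (simp add: p q mpoly_eval_sum mpoly_eval_single monom_eval_add mpoly_eval_superset[OF _ order_refl]
        sum_product mult_ac)
  moreover have "?r \<in> mpolys_over K n"
  proof (intro mpolys_over_sum mpolys_over_single assms)
    fix m m' assume *: "m \<in> Poly_Mapping.keys p" "m' \<in> Poly_Mapping.keys q"
    then show "Poly_Mapping.lookup p m * Poly_Mapping.lookup q m' \<in> K"
      using p q by (auto simp: mpolys_over_def intro: mult_mem)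
    have "Poly_Mapping.keys m \<subseteq> {..<n}" "Poly_Mapping.keys m' \<subseteq> {..<n}"
      using * p q by (auto simp: mpolys_over_def)
    then show "Poly_Mapping.keys (m + m') \<subseteq> {..<n}"
      using keys_add[of m m'] by blast
  qed
  ultimately show "a * b \<in> ?M" by blast
qed

text \<open>The exponent of a variable that occurs in neither monomial can be read off, so distinct
  terms stay distinct after multiplication by its powers.\<close>

lemma single_add_eq_iff:
  fixes m m' :: "nat \<Rightarrow>\<^sub>0 nat"
  assumes "i \<notin> Poly_Mapping.keys m" "i \<notin> Poly_Mapping.keys m'"
  shows "m + Poly_Mapping.single i j = m' + Poly_Mapping.single i k \<longleftrightarrow> m = m' \<and> j = k"
proof
  assume eq: "m + Poly_Mapping.single i j = m' + Poly_Mapping.single i k"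
  have "j = k"
    using arg_cong[OF eq, of "\<lambda>p. Poly_Mapping.lookup p i"] assms
    by (simp add: lookup_add in_keys_iff)
  then show "m = m' \<and> j = k" using eq by simp
qed simp

text \<open>Suppose \<open>y i\<close> is a root of a polynomial over the ring generated by the
  earlier elements. Its coefficients are values of multivariate polynomials, and unfolding them
  gives a nontrivial relation over \<open>K\<close>, which independence excludes.\<close>

lemma alg_independent_over_not_algebraic:
  assumes "subring_set K" "alg_independent_over K n y" "i < n"
  shows "y i \<notin> alg_cl (y ` {..<i})"
proof
  interpret subring_set K by fact
  assume "y i \<in> alg_cl (y ` {..<i})"
  then obtain f where f: "f \<in> polys_over (ring_gen (y ` {..<i}))" "f \<noteq> 0" "poly f (y i) = 0"
    by (auto simp: alg_cl_def algebraic_over_def)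
  have "y j \<in> mpoly_eval y ` mpolys_over K i" if "j < i" for j
    by (rule image_eqI[OF _ mpolys_over_single[of 1 _ "Poly_Mapping.single j 1"]])
       (use that in \<open>auto simp: one_mem mpoly_eval_single monom_eval_single\<close>)
  then have "ring_gen (y ` {..<i}) \<subseteq> mpoly_eval y ` mpolys_over K i"
    by (intro ring_gen_least mpoly_eval_image_subring assms) auto
  then have "\<exists>q\<in>mpolys_over K i. coeff f j = mpoly_eval y q" for j
    using polys_over_coeff[OF f(1), of j] by auto
  then obtain q where q: "\<And>j. q j \<in> mpolys_over K i" "\<And>j. coeff f j = mpoly_eval y (q j)"
    by metis
  define d where "d = degree f"
  \<comment> \<open>The variable with number \<open>i\<close> plays the role of the unknown of
    \<open>f\<close>, and the coefficients are replaced by the polynomials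
    \<open>q j\<close>.\<close>
  define Q where "Q = (\<Sum>j\<le>d. \<Sum>m\<in>Poly_Mapping.keys (q j).
    Poly_Mapping.single (m + Poly_Mapping.single i j) (Poly_Mapping.lookup (q j) m))"
  have q_keys: "Poly_Mapping.keys m \<subseteq> {..<i}" "Poly_Mapping.lookup (q j) m \<in> K"
    if "m \<in> Poly_Mapping.keys (q j)" for j m
    using q(1)[of j] that by (auto simp: mpolys_over_def)
  have "Q \<in> mpolys_over K n"
    unfolding Q_def
  proof (intro mpolys_over_sum mpolys_over_single assms)
    fix j m assume m: "m \<in> Poly_Mapping.keys (q j)"
    show "Poly_Mapping.lookup (q j) m \<in> K" using q_keys(2)[OF m] .
    show "Poly_Mapping.keys (m + Poly_Mapping.single i j) \<subseteq> {..<n}"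
      using keys_add[of m "Poly_Mapping.single i j"] q_keys(1)[OF m] \<open>i < n\<close>
      by (auto split: if_splits)
  qed
  moreover have "mpoly_eval y Q = poly f (y i)"
    by (simp add: Q_def mpoly_eval_sum mpoly_eval_single monom_eval_add monom_eval_single
        poly_altdef[of f] d_def q(2) mpoly_eval_superset[OF _ order_refl] sum_distrib_left mult_ac)
  ultimately have "Q = 0"
    using assms(2) f(3) unfolding alg_independent_over_def mpolys_over_def by auto
  have "q d \<noteq> 0"
    using f(2) q(2)[of d] by (auto simp: d_def mpoly_eval_zero)
  then obtain m0 where m0: "m0 \<in> Poly_Mapping.keys (q d)"
    by (metis all_not_in_conv keys_eq_empty)
  \<comment> \<open>The polynomials \<open>q j\<close> involve only variables below
    \<open>i\<close>, so different pairs of \<open>j\<close> and \<open>m\<close> give different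
    monomials and nothing can cancel.\<close>
  have "Poly_Mapping.lookup Q (m0 + Poly_Mapping.single i d) =
      (\<Sum>j\<le>d. \<Sum>m\<in>Poly_Mapping.keys (q j). if m = m0 \<and> j = d then Poly_Mapping.lookup (q j) m else 0)"
    unfolding Q_def lookup_sum
  proof (intro sum.cong refl)
    fix j m assume m: "m \<in> Poly_Mapping.keys (q j)"
    have "i \<notin> Poly_Mapping.keys m" "i \<notin> Poly_Mapping.keys m0"
      using q_keys(1)[OF m] q_keys(1)[OF m0] by auto
    then show "Poly_Mapping.lookup (Poly_Mapping.single (m + Poly_Mapping.single i j)
        (Poly_Mapping.lookup (q j) m)) (m0 + Poly_Mapping.single i d) =
        (if m = m0 \<and> j = d then Poly_Mapping.lookup (q j) m else 0)"
      by (simp add: lookup_single single_add_eq_iff when_def)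
  qed
  also have "\<dots> = (\<Sum>j\<le>d. if j = d then Poly_Mapping.lookup (q d) m0 else 0)"
    using m0 by (intro sum.cong refl) (auto simp: if_distrib cong: if_cong)
  also have "\<dots> = Poly_Mapping.lookup (q d) m0" by simp
  finally show False using m0 \<open>Q = 0\<close> by (simp add: in_keys_iff)
qed

section \<open>Algebraic numbers and exponential polynomials\<close>

lemma ring_gen_empty: "ring_gen {} = (\<int> :: 'a::comm_ring_1 set)"
proof
  have "subring_set (\<int> :: 'a set)" by unfold_locales auto
  then show "ring_gen {} \<subseteq> (\<int> :: 'a set)" by (rule ring_gen_least) simp
  have "of_nat n \<in> ring_gen ({} :: 'a set)" for n
    by (induction n) (auto intro: ring_gen.zero_mem ring_gen.one_mem ring_gen.add_mem)
  then show "(\<int> :: 'a set) \<subseteq> ring_gen {}"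
    by (auto elim!: Ints_cases) (metis of_int_of_nat ring_gen.uminus_mem)
qed

text \<open>Without generators the generated ring consists of the integers. The field operations on
  algebraic numbers are thus inherited from \<open>alg_cl\<close>.\<close>

lemma algebraic_numbers_eq_alg_cl: "algebraic_numbers = alg_cl {}"
  by (auto simp: algebraic_numbers_def alg_cl_def algebraic_over_def algebraic_def polys_over_def
      ring_gen_empty)

interpretation algebraic_numbers: subring_set algebraic_numbers
  unfolding algebraic_numbers_eq_alg_cl by (rule alg_cl.subring_set_axioms)

lemma algebraic_numbers_subset_alg_cl: "algebraic_numbers \<subseteq> alg_cl H"
  unfolding algebraic_numbers_eq_alg_cl by (rule alg_cl_mono) simp

lemma algebraic_numbers_inverse: "a \<in> algebraic_numbers \<Longrightarrow> inverse a \<in> algebraic_numbers"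
  unfolding algebraic_numbers_eq_alg_cl by (rule alg_cl_inverse)

lemma exp_poly_term:
  assumes "P \<in> polys_over algebraic_numbers" "\<beta> \<in> algebraic_numbers"
  shows "exp_poly (\<lambda>x. poly P x * exp (\<beta> * x))"
  unfolding exp_poly_def
  by (rule exI[of _ 1], rule exI[of _ "\<lambda>_. P"], rule exI[of _ "\<lambda>_. \<beta>"])
     (use assms in \<open>auto simp: polys_over_def\<close>)

lemma exp_poly_const: "c \<in> algebraic_numbers \<Longrightarrow> exp_poly (\<lambda>x. c)"
  using exp_poly_term[of "[:c:]" 0] algebraic_numbers.const_polys_over algebraic_numbers.zero_mem by simp

lemma exp_poly_exp: "\<beta> \<in> algebraic_numbers \<Longrightarrow> exp_poly (\<lambda>x. exp (\<beta> * x))"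
  using exp_poly_term[of 1 \<beta>] algebraic_numbers.polys_one_mem by simp

lemma exp_poly_ident: "exp_poly (\<lambda>x. x)"
proof -
  have "[:0, 1:] \<in> polys_over algebraic_numbers"
    by (intro algebraic_numbers.pCons_polys_over algebraic_numbers.zero_mem
        algebraic_numbers.one_mem algebraic_numbers.polys_zero_mem)
  from exp_poly_term[OF this algebraic_numbers.zero_mem] show ?thesis by simp
qed

lemma exp_polyE:
  assumes "exp_poly f"
  obtains N P \<beta> where "\<And>i. i < N \<Longrightarrow> P i \<in> polys_over algebraic_numbers"
    "\<And>i. i < N \<Longrightarrow> \<beta> i \<in> algebraic_numbers"
    "f = (\<lambda>x. \<Sum>i<(N::nat). poly (P i) x * exp (\<beta> i * x))"
proof -
  from assms obtain N :: nat and P \<beta>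
    where "\<forall>i<N. (\<forall>j. coeff (P i) j \<in> algebraic_numbers) \<and> \<beta> i \<in> algebraic_numbers"
      "f = (\<lambda>x. \<Sum>i<N. poly (P i) x * exp (\<beta> i * x))"
    by (auto simp: exp_poly_def)
  then show thesis by (intro that[of N P \<beta>]) (auto simp: polys_over_def)
qed

lemma exp_poly_add:
  assumes "exp_poly f" "exp_poly g"
  shows "exp_poly (\<lambda>x. f x + g x)"
proof -
  obtain N P \<beta> where f: "N \<ge> 1"
      "\<forall>i<N. (\<forall>j. coeff (P i) j \<in> algebraic_numbers) \<and> \<beta> i \<in> algebraic_numbers"
      "f = (\<lambda>x. \<Sum>i<(N::nat). poly (P i) x * exp (\<beta> i * x))"
    using assms(1) by (auto simp: exp_poly_def)
  obtain M Q \<gamma> where g: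
      "\<forall>i<M. (\<forall>j. coeff (Q i) j \<in> algebraic_numbers) \<and> \<gamma> i \<in> algebraic_numbers"
      "g = (\<lambda>x. \<Sum>i<(M::nat). poly (Q i) x * exp (\<gamma> i * x))"
    using assms(2) by (auto simp: exp_poly_def)
  have split: "(\<Sum>i<N + M. h i) = (\<Sum>i<N. h i) + (\<Sum>i<M. h (N + i))" for h :: "nat \<Rightarrow> complex"
    by (induction M) (simp_all add: add.assoc)
  show ?thesis
    unfolding exp_poly_def
    by (rule exI[of _ "N + M"], rule exI[of _ "\<lambda>i. if i < N then P i else Q (i - N)"],
        rule exI[of _ "\<lambda>i. if i < N then \<beta> i else \<gamma> (i - N)"])
       (use f g in \<open>auto simp: split\<close>)
qed

lemma exp_poly_sum: "(\<And>i. i \<in> I \<Longrightarrow> exp_poly (f i)) \<Longrightarrow> exp_poly (\<lambda>x. \<Sum>i\<in>I. f i x)"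
  by (induction I rule: infinite_finite_induct)
     (auto intro: exp_poly_add exp_poly_const algebraic_numbers.zero_mem)

lemma exp_poly_mult:
  assumes "exp_poly f" "exp_poly g"
  shows "exp_poly (\<lambda>x. f x * g x)"
proof -
  obtain N P \<beta> where f: "\<And>i. i < N \<Longrightarrow> P i \<in> polys_over algebraic_numbers"
    "\<And>i. i < N \<Longrightarrow> \<beta> i \<in> algebraic_numbers"
    "f = (\<lambda>x. \<Sum>i<(N::nat). poly (P i) x * exp (\<beta> i * x))"
    using assms(1) by (rule exp_polyE) blast
  obtain M Q \<gamma> where g: "\<And>i. i < M \<Longrightarrow> Q i \<in> polys_over algebraic_numbers"
    "\<And>i. i < M \<Longrightarrow> \<gamma> i \<in> algebraic_numbers"
    "g = (\<lambda>x. \<Sum>i<(M::nat). poly (Q i) x * exp (\<gamma> i * x))"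
    using assms(2) by (rule exp_polyE) blast
  have "exp_poly (\<lambda>x. \<Sum>i<N. \<Sum>j<M. poly (P i * Q j) x * exp ((\<beta> i + \<gamma> j) * x))"
    using f g by (intro exp_poly_sum exp_poly_term)
      (auto intro: algebraic_numbers.polys_mult_mem algebraic_numbers.add_mem)
  then show ?thesis
    by (simp add: f g sum_product distrib_right distrib_left exp_add mult_ac)
qed

lemma exp_poly_diff:
  assumes "exp_poly f" "exp_poly g"
  shows "exp_poly (\<lambda>x. f x - g x)"
proof -
  have "exp_poly (\<lambda>x. (- 1) * g x)"
    using assms(2) algebraic_numbers.uminus_mem[OF algebraic_numbers.one_mem]
    by (intro exp_poly_mult exp_poly_const)
  from exp_poly_add[OF assms(1) this] show ?thesis by simp
qed

lemma exp_poly_holomorphic: "exp_poly f \<Longrightarrow> f holomorphic_on A"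
  by (auto simp: exp_poly_def intro!: holomorphic_intros)

section \<open>Integral bases of frequencies\<close>

interpretation rat_vs: vector_space "\<lambda>(q::rat) (z::complex). of_rat q * z"
  by unfold_locales (auto simp: algebra_simps of_rat_add of_rat_mult)

lemma finite_rat_common_denominator:
  assumes "finite (Q :: rat set)"
  shows "\<exists>D::nat. D > 0 \<and> (\<forall>q\<in>Q. of_nat D * q \<in> \<int>)"
  using assms
proof (induction Q)
  case (insert q Q)
  then obtain D :: nat where D: "D > 0" "\<forall>q\<in>Q. of_nat D * q \<in> \<int>" by auto
  obtain a b where ab: "quotient_of q = (a, b)" by force
  then have b: "b > 0" "q = of_int a / of_int b"
    using quotient_of_denom_pos quotient_of_div by blast+
  have nb: "of_nat (nat b) = (of_int b :: rat)" using b(1) by simp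
  have "of_nat (D * nat b) * q = of_int (int D * a)" using b by (simp add: nb)
  then have "of_nat (D * nat b) * q \<in> \<int>" by (simp only: Ints_of_int)
  moreover have "of_nat (D * nat b) * r \<in> \<int>" if "r \<in> Q" for r
  proof -
    have "of_nat (D * nat b) * r = of_int b * (of_nat D * r)" by (simp add: nb)
    also have "\<dots> \<in> \<int>" using D(2) that by (auto intro!: Ints_mult[of "of_int b"])
    finally show ?thesis .
  qed
  ultimately show ?case using D b by (intro exI[of _ "D * nat b"]) auto
qed auto

text \<open>Applied to the division by a common denominator and to the multiplication by the point
  \<xi>.\<close>

lemma rat_independent_scale:
  assumes "rat_independent n b" "c \<noteq> 0"
  shows "rat_independent n (\<lambda>i. c * b i)"
proof -
  let ?B = "b ` {..<n}"
  have inj: "inj_on (\<lambda>i. c * b i) {..<n}"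
    using assms by (auto simp: rat_independent_def inj_on_def)
  have "\<not> rat_vs.dependent ((\<lambda>v. c * v) ` ?B)"
  proof
    assume "rat_vs.dependent ((\<lambda>v. c * v) ` ?B)"
    then obtain u where u: "\<exists>v\<in>(\<lambda>v. c * v) ` ?B. u v \<noteq> 0" "(\<Sum>v\<in>(\<lambda>v. c * v) ` ?B. of_rat (u v) * v) = 0"
      using rat_vs.dependent_finite[of "(\<lambda>v. c * v) ` ?B"] by auto
    have "(\<Sum>v\<in>(\<lambda>v. c * v) ` ?B. of_rat (u v) * v) = c * (\<Sum>v\<in>?B. of_rat (u (c * v)) * v)"
      using assms(2) by (subst sum.reindex) (auto simp: inj_on_def sum_distrib_left mult_ac)
    then have "(\<Sum>v\<in>?B. of_rat (u (c * v)) * v) = 0" using u(2) assms(2) by simp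
    then have "rat_vs.dependent ?B"
      using u(1) rat_vs.dependent_finite[of ?B] by (auto intro!: exI[of _ "\<lambda>v. u (c * v)"])
    then show False using assms(1) by (simp add: rat_independent_def)
  qed
  then show ?thesis using inj by (simp add: rat_independent_def image_image)
qed

text \<open>A maximal independent subset of \<open>B\<close> gives rational coordinates; dividing
  its elements by a common denominator \<open>D\<close> of all coordinates makes these
  integral.\<close>

lemma integral_basis:
  assumes "finite B" "B \<subseteq> algebraic_numbers"
  obtains n b where "rat_independent n b" "\<And>i. i < n \<Longrightarrow> b i \<in> algebraic_numbers"
    "\<And>\<beta>. \<beta> \<in> B \<Longrightarrow> \<exists>k::nat \<Rightarrow> int. \<beta> = (\<Sum>i<n. of_int (k i) * b i)"
proof -
  obtain B' where B': "B' \<subseteq> B" "\<not> rat_vs.dependent B'" "B \<subseteq> rat_vs.span B'"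
    using rat_vs.maximal_independent_subset[of B] by blast
  have fin: "finite B'" using B'(1) assms(1) finite_subset by blast
  obtain b' where "bij_betw b' {..<card B'} B'"
    using fin ex_bij_betw_nat_finite[OF fin] atLeast0LessThan by metis
  then have b': "inj_on b' {..<card B'}" "b' ` {..<card B'} = B'" by (auto simp: bij_betw_def)
  define n where "n = card B'"
  have "\<exists>u. \<beta> = (\<Sum>v\<in>B'. of_rat (u v) * v)" if "\<beta> \<in> B" for \<beta>
    using that B'(3) by (auto simp: rat_vs.span_finite[OF fin])
  then obtain u where u: "\<And>\<beta>. \<beta> \<in> B \<Longrightarrow> \<beta> = (\<Sum>v\<in>B'. of_rat (u \<beta> v) * v)" by metis
  obtain D :: nat where D: "D > 0" "\<forall>q\<in>(\<lambda>(\<beta>, v). u \<beta> v) ` (B \<times> B'). of_nat D * q \<in> \<int>"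
    using finite_rat_common_denominator[of "(\<lambda>(\<beta>, v). u \<beta> v) ` (B \<times> B')"] assms(1) fin by auto
  define b where "b = (\<lambda>i. inverse (of_nat D) * b' i)"
  have "rat_independent n b'" using b' B'(2) by (simp add: rat_independent_def n_def)
  then have "rat_independent n b"
    unfolding b_def using D(1) by (intro rat_independent_scale) auto
  moreover have "b i \<in> algebraic_numbers" if "i < n" for i
  proof -
    have "b' i \<in> algebraic_numbers" using that b'(2) B'(1) assms(2) by (auto simp: n_def)
    moreover have "of_nat D \<in> algebraic_numbers" by (simp add: algebraic_numbers_def)
    ultimately show ?thesis
      unfolding b_def by (intro algebraic_numbers.mult_mem algebraic_numbers_inverse)
  qed
  moreover have "\<exists>k::nat \<Rightarrow> int. \<beta> = (\<Sum>i<n. of_int (k i) * b i)" if \<beta>: "\<beta> \<in> B" for \<beta>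
  proof -
    have "\<exists>k::int. of_nat D * u \<beta> (b' i) = of_int k" if "i < n" for i
    proof -
      have "b' i \<in> B'" using that b'(2) by (auto simp: n_def)
      then have "of_nat D * u \<beta> (b' i) \<in> \<int>" using D(2) \<beta> by auto
      then show ?thesis by (auto elim: Ints_cases)
    qed
    then obtain k where k: "\<And>i. i < n \<Longrightarrow> of_nat D * u \<beta> (b' i) = of_int (k i)" by metis
    have "(\<Sum>v\<in>B'. of_rat (u \<beta> v) * v) = (\<Sum>i<n. of_rat (u \<beta> (b' i)) * b' i)"
      using sum.reindex[OF b'(1), of "\<lambda>v. of_rat (u \<beta> v) * v"] by (simp add: b'(2) n_def)
    with u[OF \<beta>] have "\<beta> = (\<Sum>i<n. of_rat (u \<beta> (b' i)) * b' i)" by (rule trans)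
    also have "\<dots> = (\<Sum>i<n. of_int (k i) * b i)"
    proof (rule sum.cong[OF refl])
      fix i assume "i \<in> {..<n}"
      then have "of_rat (of_nat D * u \<beta> (b' i)) = (of_rat (of_int (k i)) :: complex)"
        using k by simp
      then have "of_nat D * of_rat (u \<beta> (b' i)) = (of_int (k i) :: complex)"
        by (simp add: of_rat_mult)
      then show "of_rat (u \<beta> (b' i)) * b' i = of_int (k i) * b i"
        using D(1) by (simp add: b_def field_simps)
    qed
    finally show ?thesis by blast
  qed
  ultimately show thesis by (rule that)
qed

text \<open>Multiplying by a suitable exponential turns integral exponents into natural ones.\<close>

lemma exp_poly_shift_natural_exponents:
  fixes N n :: nat
  assumes N: "\<And>i. i < N \<Longrightarrow> P i \<in> polys_over algebraic_numbers"
    and \<beta>: "\<And>i. i < N \<Longrightarrow> \<exists>k::nat \<Rightarrow> int. \<beta> i = (\<Sum>l<n. of_int (k l) * b l)"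
    and b: "\<And>l. l < n \<Longrightarrow> b l \<in> algebraic_numbers"
    and S_const: "\<And>c. c \<in> algebraic_numbers \<Longrightarrow> (\<lambda>x. c) \<in> S"
    and S_ident: "(\<lambda>x. x) \<in> S" and S_exp: "\<And>l. l < n \<Longrightarrow> (\<lambda>x. exp (b l * x)) \<in> S"
    and S_add: "\<And>f g. f \<in> S \<Longrightarrow> g \<in> S \<Longrightarrow> (\<lambda>x. f x + g x) \<in> S"
    and S_mult: "\<And>f g. f \<in> S \<Longrightarrow> g \<in> S \<Longrightarrow> (\<lambda>x. f x * g x) \<in> S"
  shows "\<exists>\<gamma>\<in>algebraic_numbers.
           (\<lambda>x::complex. exp (\<gamma> * x) * (\<Sum>i<N. poly (P i) x * exp (\<beta> i * x))) \<in> S"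
proof -
  have S_sum: "(\<lambda>x. \<Sum>i\<in>I. f i x) \<in> S" if "\<And>i. i \<in> I \<Longrightarrow> f i \<in> S" for I and f :: "nat \<Rightarrow> complex \<Rightarrow> complex"
    using that by (induction I rule: infinite_finite_induct)
      (auto intro: S_add S_const algebraic_numbers.zero_mem)
  have S_prod: "(\<lambda>x. \<Prod>i\<in>I. f i x) \<in> S" if "\<And>i. i \<in> I \<Longrightarrow> f i \<in> S" for I and f :: "nat \<Rightarrow> complex \<Rightarrow> complex"
    using that by (induction I rule: infinite_finite_induct)
      (auto intro: S_mult S_const algebraic_numbers.one_mem)
  have S_power: "(\<lambda>x. f x ^ m) \<in> S" if "f \<in> S" for f m
    using that by (induction m) (auto intro: S_mult S_const algebraic_numbers.one_mem)
  obtain k :: "nat \<Rightarrow> nat \<Rightarrow> int" where k: "\<And>i. i < N \<Longrightarrow> \<beta> i = (\<Sum>l<n. of_int (k i l) * b l)"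
    using \<beta> by metis
  \<comment> \<open>\<open>M\<close> bounds the absolute values of all exponents, and multiplication
    by the exponential of \<open>\<gamma> * x\<close> raises each exponent by
    \<open>M\<close>.\<close>
  define M where "M = (\<Sum>(i, l)\<in>{..<N} \<times> {..<n}. nat \<bar>k i l\<bar>)"
  have M: "k i l + int M \<ge> 0" if "i < N" "l < n" for i l
  proof -
    have "nat \<bar>k i l\<bar> \<le> M"
      unfolding M_def using that member_le_sum[of "(i, l)" "{..<N} \<times> {..<n}" "\<lambda>(i, l). nat \<bar>k i l\<bar>"]
      by auto
    then show ?thesis by linarith
  qed
  define \<gamma> where "\<gamma> = (\<Sum>l<n. of_nat M * b l)"
  have "\<gamma> \<in> algebraic_numbers"
    unfolding \<gamma>_def by (intro algebraic_numbers.sum_mem algebraic_numbers.mult_mem b)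
      (auto simp: algebraic_numbers_def)
  moreover have "exp (\<gamma> * x) * exp (\<beta> i * x) = (\<Prod>l<n. exp (b l * x) ^ nat (k i l + int M))"
    if "i < N" for i x
  proof -
    have "exp (\<gamma> * x) * exp (\<beta> i * x) = exp (\<Sum>l<n. of_nat (nat (k i l + int M)) * (b l * x))"
      unfolding \<gamma>_def k[OF that] exp_add[symmetric] sum_distrib_right sum.distrib[symmetric]
      using M[OF that] by (intro arg_cong[of _ _ exp] sum.cong) (auto simp: algebra_simps)
    then show ?thesis by (simp add: exp_sum exp_of_nat_mult)
  qed
  then have "exp (\<gamma> * x) * (\<Sum>i<N. poly (P i) x * exp (\<beta> i * x)) =
      (\<Sum>i<N. (\<Sum>j\<le>degree (P i). coeff (P i) j * x ^ j) * (\<Prod>l<n. exp (b l * x) ^ nat (k i l + int M)))" for x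
    by (simp add: sum_distrib_left mult.left_commute flip: poly_altdef cong: sum.cong_simp)
  moreover have "(\<lambda>x. \<Sum>i<N. (\<Sum>j\<le>degree (P i). coeff (P i) j * x ^ j) *
      (\<Prod>l<n. exp (b l * x) ^ nat (k i l + int M))) \<in> S"
    using N by (intro S_sum S_mult S_prod S_power S_const S_ident S_exp polys_over_coeff) auto
  ultimately show ?thesis by (intro bexI[of _ \<gamma>]) (simp_all only:)
qed

section \<open>Homomorphisms on subrings\<close>

locale subring_hom = subring_set R for R :: "'a::comm_ring_1 set" +
  fixes h :: "'a \<Rightarrow> 'b::comm_ring_1"
  assumes h_one: "h 1 = 1"
    and h_diff: "a \<in> R \<Longrightarrow> b \<in> R \<Longrightarrow> h (a - b) = h a - h b"
    and h_mult: "a \<in> R \<Longrightarrow> b \<in> R \<Longrightarrow> h (a * b) = h a * h b"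
begin

lemma h_zero: "h 0 = 0"
  using h_diff[OF one_mem one_mem] by simp

lemma h_add:
  assumes "a \<in> R" "b \<in> R" shows "h (a + b) = h a + h b"
  using h_diff[OF assms(1) uminus_mem[OF assms(2)]] h_diff[OF zero_mem assms(2)] by (simp add: h_zero)

lemma h_sum: "(\<And>i. i \<in> I \<Longrightarrow> f i \<in> R) \<Longrightarrow> h (sum f I) = (\<Sum>i\<in>I. h (f i))"
  by (induction I rule: infinite_finite_induct) (auto simp: h_zero h_add sum_mem)

lemma map_poly_diff:
  "p \<in> polys_over R \<Longrightarrow> q \<in> polys_over R \<Longrightarrow> map_poly h (p - q) = map_poly h p - map_poly h q"
  by (intro poly_eqI) (simp add: coeff_map_poly h_zero h_diff polys_over_coeff)

lemma map_poly_add: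
  "p \<in> polys_over R \<Longrightarrow> q \<in> polys_over R \<Longrightarrow> map_poly h (p + q) = map_poly h p + map_poly h q"
  by (intro poly_eqI) (simp add: coeff_map_poly h_zero h_add polys_over_coeff)

lemma map_poly_mult:
  assumes "p \<in> polys_over R" "q \<in> polys_over R"
  shows "map_poly h (p * q) = map_poly h p * map_poly h q"
proof (rule poly_eqI)
  fix n
  have "h (coeff (p * q) n) = (\<Sum>i\<le>n. h (coeff p i * coeff q (n - i)))"
    unfolding coeff_mult using assms by (intro h_sum mult_mem polys_over_coeff)
  then show "coeff (map_poly h (p * q)) n = coeff (map_poly h p * map_poly h q) n"
    using assms by (simp add: coeff_map_poly h_zero coeff_mult h_mult polys_over_coeff)
qed

lemma map_poly_one: "map_poly h 1 = 1"
  by (simp add: map_poly_1 h_one)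

end

text \<open>As \<open>z\<close> is transcendental over \<open>R\<close>, an element of the extension
  is represented by only one polynomial. So the choice in \<open>h'\<close> is well defined, and the
  image \<open>v\<close> of \<open>z\<close> is free.\<close>

lemma subring_hom_extend:
  fixes h :: "'a::comm_ring_1 \<Rightarrow> 'b::comm_ring_1"
  assumes "subring_hom R h" "\<not> algebraic_over R z"
  obtains h' where "subring_hom ((\<lambda>p. poly p z) ` polys_over R) h'"
    "\<And>r. r \<in> R \<Longrightarrow> h' r = h r" "h' z = v"
proof -
  interpret subring_hom R h by fact
  define h' where
    "h' = (\<lambda>a. poly (map_poly h (SOME p. p \<in> polys_over R \<and> poly p z = a)) v)"
  have h': "h' (poly p z) = poly (map_poly h p) v" if p: "p \<in> polys_over R" for p
  proof -
    define q where "q = (SOME q. q \<in> polys_over R \<and> poly q z = poly p z)"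
    have q: "q \<in> polys_over R \<and> poly q z = poly p z"
      unfolding q_def by (rule someI[of "\<lambda>q. q \<in> polys_over R \<and> poly q z = poly p z" p]) (use p in simp)
    then have "q - p = 0"
      using assms(2) polys_diff_mem[of q p] p unfolding algebraic_over_def by force
    then show ?thesis by (simp add: h'_def flip: q_def)
  qed
  show thesis
  proof (rule that[of h'])
    interpret I: subring_set "(\<lambda>p. poly p z) ` polys_over R" by (rule eval_image_subring)
    show "subring_hom ((\<lambda>p. poly p z) ` polys_over R) h'"
    proof
      show "h' 1 = 1" using h'[OF polys_one_mem] by (simp add: map_poly_one)
      fix a b assume "a \<in> (\<lambda>p. poly p z) ` polys_over R" "b \<in> (\<lambda>p. poly p z) ` polys_over R"
      then obtain p q where p: "p \<in> polys_over R" "a = poly p z" and q: "q \<in> polys_over R" "b = poly q z"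
        by blast
      show "h' (a - b) = h' a - h' b"
        using h'[OF polys_diff_mem[OF p(1) q(1)]] h'[OF p(1)] h'[OF q(1)] p q
        by (simp add: map_poly_diff)
      show "h' (a * b) = h' a * h' b"
        using h'[OF polys_mult_mem[OF p(1) q(1)]] h'[OF p(1)] h'[OF q(1)] p q
        by (simp add: map_poly_mult)
    qed
    show "h' r = h r" if "r \<in> R" for r
      using h'[OF const_polys_over[OF that]] by (simp add: map_poly_pCons h_zero)
    have "[:0, 1:] \<in> polys_over R"
      by (intro pCons_polys_over polys_zero_mem zero_mem one_mem)
    from h'[OF this] show "h' z = v" by (simp add: map_poly_pCons h_zero h_one)
  qed
qed

lemma insert_chain: "K \<union> w ` {..<Suc n} = insert (w n) (K \<union> w ` {..<n})"
  by (auto simp: lessThan_Suc)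

text \<open>The elements \<open>w k\<close> behave like independent variables over \<open>K\<close>,
  so any images \<open>v\<close> can be prescribed for them.\<close>

lemma subring_hom_chain:
  fixes K :: "'a::comm_ring_1 set" and n :: nat
  assumes "\<And>k. k < n \<Longrightarrow> \<not> algebraic_over (ring_gen (K \<union> w ` {..<k})) (w k)"
  shows "\<exists>h. subring_hom (ring_gen (K \<union> w ` {..<n})) h \<and> (\<forall>c\<in>K. h c = c) \<and> (\<forall>i<n. h (w i) = v i)"
  using assms
proof (induction n)
  case 0
  have "subring_hom (ring_gen K) (\<lambda>x. x)" by unfold_locales auto
  then show ?case by (intro exI[of _ "\<lambda>x. x"]) auto
next
  case (Suc n)
  then obtain h where h: "subring_hom (ring_gen (K \<union> w ` {..<n})) h" "\<forall>c\<in>K. h c = c" "\<forall>i<n. h (w i) = v i"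
    by auto
  obtain h' where h': "subring_hom (ring_gen (K \<union> w ` {..<Suc n})) h'"
    "\<And>r. r \<in> ring_gen (K \<union> w ` {..<n}) \<Longrightarrow> h' r = h r" "h' (w n) = v n"
    using subring_hom_extend[OF h(1) Suc.prems[of n]] unfolding insert_chain ring_gen_insert by auto
  then show ?case
    using h by (intro exI[of _ h']) (auto simp: less_Suc_eq ring_gen_incl)
qed

lemma factorial_subring_chain:
  fixes K :: "'a::idom set" and n :: nat
  assumes "factorial_subring K"
    and "\<And>k. k < n \<Longrightarrow> \<not> algebraic_over (ring_gen (K \<union> w ` {..<k})) (w k)"
  shows "factorial_subring (ring_gen (K \<union> w ` {..<n}))"
  using assms(2)
proof (induction n)
  case 0
  have "ring_gen K = K"
    using ring_gen_least[of K K] factorial_subring.axioms(1)[OF assms(1)] by (auto intro: ring_gen_incl)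
  then show ?case using assms(1) by simp
next
  case (Suc n)
  then show ?case
    unfolding insert_chain ring_gen_insert by (intro factorial_subring_adjoin_transcendental) auto
qed

section \<open>The consequence of Schanuel's conjecture\<close>

lemma alg_independent_over_mono: "alg_independent_over K m y \<Longrightarrow> n \<le> m \<Longrightarrow> alg_independent_over K n y"
  unfolding alg_independent_over_def by (meson lessThan_subset_iff order_trans)

lemma generate_field_subset_alg_cl:
  fixes H :: "'a::field set"
  assumes "H \<subseteq> alg_cl H'" shows "generate_field type_ring H \<subseteq> alg_cl H'"
  by (rule field.generate_field_min_subfield1[OF type_ring_field _ alg_cl_subfield assms]) simp

text \<open>The supremum can be \<infinity>, and then no length attains it. Therefore a family
  longer than \<open>n - 1\<close> is taken and cut down to length \<open>n\<close>; positivity of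
  \<open>n\<close> keeps \<open>n - 1\<close> strictly below \<open>n\<close>.\<close>

lemma transcendence_degree_ge_obtains:
  assumes "transcendence_degree K L \<ge> enat n" "n > 0"
  obtains y where "y ` {..<n} \<subseteq> L" "alg_independent_over K n y"
proof -
  let ?A = "{enat m | m y. y ` {..<m} \<subseteq> L \<and> alg_independent_over K m y}"
  have "\<exists>a\<in>?A. enat (n - 1) < a"
  proof (rule ccontr)
    assume "\<not> ?thesis"
    then have "Sup ?A \<le> enat (n - 1)" by (meson Sup_least linorder_not_less)
    also have "\<dots> < enat n" using assms(2) by simp
    finally show False using assms(1) unfolding transcendence_degree_def by simp
  qed
  then obtain m y where m: "n - 1 < m" "y ` {..<m} \<subseteq> L" "alg_independent_over K m y" by auto
  then have "n \<le> m" by simp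
  then show thesis
    using that[of y] m alg_independent_over_mono[OF m(3)] by (meson image_mono lessThan_subset_iff order_trans)
qed

text \<open>Since the \<open>b i\<close> are algebraic, the field in Schanuel's conjecture for the
  numbers \<open>\<xi> * b i\<close> is algebraic over the \<open>n + 1\<close> values
  \<open>z 0, ..., z n\<close>, where the index \<open>n\<close> stands for \<xi>. It contains
  \<open>n\<close> independent elements, so by exchange \<open>n\<close> of these values are
  independent.\<close>

lemma schanuel_exponentials:
  assumes "schanuel_conjecture" "rat_independent n b" "\<And>i. i < n \<Longrightarrow> b i \<in> algebraic_numbers" "\<xi> \<noteq> 0"
  defines "z \<equiv> (\<lambda>i. if i < n then exp (b i * \<xi>) else \<xi>)"
  obtains \<sigma> where "inj_on \<sigma> {..<n}" "\<sigma> ` {..<n} \<subseteq> {..n}"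
    "\<And>k. k < n \<Longrightarrow> z (\<sigma> k) \<notin> alg_cl (z ` \<sigma> ` {..<k})"
proof -
  let ?x = "\<lambda>i. \<xi> * b i"
  let ?L = "generate_field type_ring (algebraic_numbers \<union> ?x ` {..<n} \<union> (\<lambda>i. exp (?x i)) ` {..<n})"
  have "rat_independent n ?x" using assms by (intro rat_independent_scale)
  then have td: "transcendence_degree algebraic_numbers ?L \<ge> enat n"
    using assms(1) unfolding schanuel_conjecture_def by blast
  \<comment> \<open>The family is only asserted for positive \<open>n\<close>, as
    \<open>transcendence_degree_ge_obtains\<close> demands; for \<open>n = 0\<close> all later
    claims about \<open>y i\<close> are vacuous.\<close>
  obtain y where y: "n > 0 \<Longrightarrow> y ` {..<n} \<subseteq> ?L" "n > 0 \<Longrightarrow> alg_independent_over algebraic_numbers n y"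
    using transcendence_degree_ge_obtains[OF td] by blast
  have z: "z i \<in> alg_cl (z ` {..n})" if "i \<le> n" for i
    using alg_cl_incl[of "z ` {..n}"] that by auto
  have "\<xi> * b i \<in> alg_cl (z ` {..n})" "exp (\<xi> * b i) \<in> alg_cl (z ` {..n})" if "i < n" for i
    using that z[of n] z[of i] assms(3)[OF that] algebraic_numbers_subset_alg_cl[of "z ` {..n}"]
    by (auto simp: z_def mult.commute intro!: alg_cl.mult_mem)
  then have "?L \<subseteq> alg_cl (z ` {..n})"
    using algebraic_numbers_subset_alg_cl by (intro generate_field_subset_alg_cl) auto
  then have "y i \<in> alg_cl (z ` {..n})" if "i < n" for i
    using y(1) that by (cases n) auto
  moreover have "y i \<notin> alg_cl (y ` {..<i})" if "i < n" for i
    using alg_independent_over_not_algebraic[OF algebraic_numbers.subring_set_axioms y(2) that] that by simp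
  ultimately show thesis
    using alg_cl_independent_subfamily[of "{..n}" n y z] that by auto
qed

text \<open>The functions \<open>id\<close> and \<open>exp (b\<^sub>i x)\<close> are ordered so that the values at \<open>\<xi>\<close> of all but the last
  are algebraically independent. The homomorphisms \<open>\<phi> x\<close> map the ring \<open>R\<close> generated by
  these values to the corresponding functions at \<open>x\<close>, so that a divisibility of polynomials over \<open>R\<close> with
  the last value as root becomes a divisibility of functions.\<close>

lemma schanuel_common_divisor:
  assumes sch: "schanuel_conjecture" and h: "exp_poly h\<^sub>1" "exp_poly h\<^sub>2" "h\<^sub>1 \<noteq> (\<lambda>x. 0)"
    and \<xi>: "\<xi> \<noteq> 0" "h\<^sub>1 \<xi> = 0" "h\<^sub>2 \<xi> = 0"
  obtains \<mu> q\<^sub>1 q\<^sub>2 where "exp_poly \<mu>" "exp_poly q\<^sub>1" "exp_poly q\<^sub>2" "\<mu> \<xi> = 0"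
    "h\<^sub>1 = (\<lambda>x. \<mu> x * q\<^sub>1 x)" "h\<^sub>2 = (\<lambda>x. \<mu> x * q\<^sub>2 x)"
proof -
  obtain N\<^sub>1 P\<^sub>1 \<beta>\<^sub>1 where h1: "\<And>i. i < N\<^sub>1 \<Longrightarrow> P\<^sub>1 i \<in> polys_over algebraic_numbers"
    "\<And>i. i < N\<^sub>1 \<Longrightarrow> \<beta>\<^sub>1 i \<in> algebraic_numbers"
    "h\<^sub>1 = (\<lambda>x. \<Sum>i<(N\<^sub>1::nat). poly (P\<^sub>1 i) x * exp (\<beta>\<^sub>1 i * x))"
    using h(1) by (rule exp_polyE) blast
  obtain N\<^sub>2 P\<^sub>2 \<beta>\<^sub>2 where h2: "\<And>i. i < N\<^sub>2 \<Longrightarrow> P\<^sub>2 i \<in> polys_over algebraic_numbers"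
    "\<And>i. i < N\<^sub>2 \<Longrightarrow> \<beta>\<^sub>2 i \<in> algebraic_numbers"
    "h\<^sub>2 = (\<lambda>x. \<Sum>i<(N\<^sub>2::nat). poly (P\<^sub>2 i) x * exp (\<beta>\<^sub>2 i * x))"
    using h(2) by (rule exp_polyE) blast
  let ?B = "\<beta>\<^sub>1 ` {..<N\<^sub>1} \<union> \<beta>\<^sub>2 ` {..<N\<^sub>2}"
  have "finite ?B" "?B \<subseteq> algebraic_numbers" using h1(2) h2(2) by auto
  then obtain n b where b: "rat_independent n b" "\<And>i. i < n \<Longrightarrow> b i \<in> algebraic_numbers"
    "\<And>\<beta>. \<beta> \<in> ?B \<Longrightarrow> \<exists>k::nat \<Rightarrow> int. \<beta> = (\<Sum>i<n. of_int (k i) * b i)"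
    using integral_basis[of ?B] by auto
  \<comment> \<open>Indices below \<open>n\<close> belong to the exponentials, the index
    \<open>n\<close> to the identity function.\<close>
  define W where "W = (\<lambda>i x. if i < n then exp (b i * x) else x)"
  obtain \<sigma> where \<sigma>: "inj_on \<sigma> {..<n}" "\<sigma> ` {..<n} \<subseteq> {..n}"
    "\<And>k. k < n \<Longrightarrow> W (\<sigma> k) \<xi> \<notin> alg_cl ((\<lambda>i. W i \<xi>) ` \<sigma> ` {..<k})"
    using schanuel_exponentials[OF sch b(1,2) \<xi>(1)] unfolding W_def by blast
  \<comment> \<open>The \<open>n\<close> selected indices leave out exactly one of
    \<open>0, ..., n\<close>. It is called \<open>j\<close>, and \<open>W j \<xi>\<close> will be
    the point at which polynomials over \<open>R\<close> are evaluated.\<close>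
  have "card (\<sigma> ` {..<n}) < card {..n}" using card_image[OF \<sigma>(1)] by simp
  then obtain j where j: "j \<le> n" "j \<notin> \<sigma> ` {..<n}"
    using card_mono[of "\<sigma> ` {..<n}" "{..n}"] by (metis atMost_iff finite_imageI finite_lessThan not_le subsetI)
  have "\<sigma> ` {..<n} = {..n} - {j}"
    using \<sigma>(1,2) j by (intro card_subset_eq) (auto simp: card_image)
  then have j_or: "i = j \<or> (\<exists>k<n. i = \<sigma> k)" if "i \<le> n" for i
    using that by auto

  let ?A = algebraic_numbers
  define w where "w = (\<lambda>k. W (\<sigma> k) \<xi>)"
  have w_transc: "\<not> algebraic_over (ring_gen (?A \<union> w ` {..<k})) (w k)" if "k < n" for k
  proof
    assume "algebraic_over (ring_gen (?A \<union> w ` {..<k})) (w k)"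
    then have "w k \<in> alg_cl (?A \<union> w ` {..<k})" by (simp add: alg_cl_def)
    also have "\<dots> \<subseteq> alg_cl (w ` {..<k})"
      by (intro alg_cl_least Un_least algebraic_numbers_subset_alg_cl alg_cl_incl)
    finally show False using \<sigma>(3)[OF that] by (simp add: w_def image_image)
  qed
  define R where "R = ring_gen (?A \<union> w ` {..<n})"
  have "factorial_subring ?A"
    by (rule factorial_subring_field[OF algebraic_numbers.subring_set_axioms algebraic_numbers_inverse])
  then interpret R: factorial_subring R
    unfolding R_def using w_transc by (intro factorial_subring_chain)
  obtain \<phi> where \<phi>: "\<And>x. subring_hom R (\<phi> x)" "\<And>x c. c \<in> ?A \<Longrightarrow> \<phi> x c = c"
    "\<And>x i. i < n \<Longrightarrow> \<phi> x (w i) = W (\<sigma> i) x"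
    using subring_hom_chain[of n ?A w "\<lambda>i. W (\<sigma> i) x" for x, OF w_transc] unfolding R_def by metis
  note \<phi>_zero = subring_hom.h_zero[OF \<phi>(1)] and \<phi>_one = subring_hom.h_one[OF \<phi>(1)]
    and \<phi>_diff = subring_hom.h_diff[OF \<phi>(1)] and \<phi>_mult = subring_hom.h_mult[OF \<phi>(1)]
  have W_exp_poly: "exp_poly (W i)" for i
    using b(2) exp_poly_exp exp_poly_ident by (cases "i < n") (auto simp: W_def)
  \<comment> \<open>\<open>\<phi> \<xi>\<close> fixes the generators of \<open>R\<close> and hence
    all of \<open>R\<close>, while for fixed \<open>r\<close> the values \<open>\<phi> x r\<close>
    form the function of \<open>x\<close> that belongs to the number \<open>r\<close>.\<close>
  have \<phi>_R: "\<phi> \<xi> r = r \<and> exp_poly (\<lambda>x. \<phi> x r)" if "r \<in> R" for r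
    using that unfolding R_def
  proof induction
    case ring_gen_one
    then show ?case by (simp add: \<phi>_one exp_poly_const algebraic_numbers.one_mem)
  next
    case (ring_gen_incl r)
    then show ?case using \<phi>(2,3) W_exp_poly by (auto simp: exp_poly_const w_def)
  next
    case (ring_gen_diff r s)
    then show ?case by (simp add: \<phi>_diff exp_poly_diff flip: R_def)
  next
    case (ring_gen_mult r s)
    then show ?case by (simp add: \<phi>_mult exp_poly_mult flip: R_def)
  qed

  \<comment> \<open>A polynomial over \<open>R\<close> becomes a function of \<open>x\<close>:
    \<open>\<phi> x\<close> carries its coefficients from \<xi> to \<open>x\<close>, and the unknown
    is replaced by \<open>W j x\<close>. At \<xi> this is ordinary evaluation at
    \<open>W j \<xi>\<close>.\<close>
  define lift where "lift = (\<lambda>p x. poly (map_poly (\<phi> x) p) (W j x))"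
  have lift_mult: "lift (p * q) = (\<lambda>x. lift p x * lift q x)"
    if "p \<in> polys_over R" "q \<in> polys_over R" for p q
    using that by (simp add: lift_def subring_hom.map_poly_mult[OF \<phi>(1)])
  have lift_add: "lift (p + q) = (\<lambda>x. lift p x + lift q x)"
    if "p \<in> polys_over R" "q \<in> polys_over R" for p q
    using that by (simp add: lift_def subring_hom.map_poly_add[OF \<phi>(1)])
  have lift_const: "lift [:c:] = (\<lambda>x. \<phi> x c)" for c
    by (simp add: lift_def map_poly_pCons \<phi>_zero)
  have lift_at: "lift p \<xi> = poly p (W j \<xi>)" if "p \<in> polys_over R" for p
  proof -
    have "map_poly (\<phi> \<xi>) p = p"
      using \<phi>_R polys_over_coeff[OF that] by (intro poly_eqI) (simp add: coeff_map_poly \<phi>_zero)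
    then show ?thesis by (simp add: lift_def)
  qed
  have lift_exp_poly: "exp_poly (lift p)" if "p \<in> polys_over R" for p
    using that
  proof (induction p)
    case 0
    then show ?case by (simp add: lift_def exp_poly_const algebraic_numbers.zero_mem)
  next
    case (pCons a p)
    have a: "a \<in> R" using polys_over_coeff[OF pCons.prems, of 0] by simp
    have "p \<in> polys_over R"
      unfolding polys_over_def using polys_over_coeff[OF pCons.prems, of "Suc _"] by simp
    then have "exp_poly (\<lambda>x. \<phi> x a + W j x * lift p x)"
      using a \<phi>_R W_exp_poly pCons.IH by (intro exp_poly_add exp_poly_mult) auto
    then show ?case by (simp add: lift_def map_poly_pCons \<phi>_zero)
  qed

  \<comment> \<open>The image of \<open>lift\<close> is closed under sums and products and contains
    the algebraic constants and every \<open>W i\<close> with \<open>i \<le> n\<close>, as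
    \<open>exp_poly_shift_natural_exponents\<close> requires of its set \<open>S\<close>.\<close>
  define S where "S = lift ` polys_over R"
  have S_const: "(\<lambda>x. c) \<in> S" if "c \<in> ?A" for c
    unfolding S_def using that \<phi>(2)
    by (intro image_eqI[of _ _ "[:c:]"] R.const_polys_over) (auto simp: lift_const R_def intro: ring_gen_incl)
  have S_W: "W i \<in> S" if "i \<le> n" for i
  proof (cases "i = j")
    case True
    then show ?thesis
      unfolding S_def
      by (intro image_eqI[of _ _ "[:0, 1:]"] R.pCons_polys_over R.zero_mem R.one_mem R.polys_zero_mem)
         (simp add: lift_def map_poly_pCons \<phi>_zero \<phi>_one)
  next
    case False
    then obtain k where k: "k < n" "i = \<sigma> k" using j_or \<open>i \<le> n\<close> by blast
    then show ?thesis
      unfolding S_def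
      by (intro image_eqI[of _ _ "[:w k:]"] R.const_polys_over) (auto simp: lift_const \<phi>(3) R_def intro: ring_gen_incl)
  qed
  have S_add: "(\<lambda>x. f x + g x) \<in> S" and S_mult: "(\<lambda>x. f x * g x) \<in> S" if fg: "f \<in> S" "g \<in> S" for f g
  proof -
    obtain p q where pq: "p \<in> polys_over R" "f = lift p" "q \<in> polys_over R" "g = lift q"
      using fg unfolding S_def by blast
    show "(\<lambda>x. f x + g x) \<in> S"
      unfolding S_def pq(2,4) lift_add[OF pq(1,3), symmetric]
      by (intro imageI R.polys_add_mem pq)
    show "(\<lambda>x. f x * g x) \<in> S"
      unfolding S_def pq(2,4) lift_mult[OF pq(1,3), symmetric]
      by (intro imageI R.polys_mult_mem pq)
  qed
  have S_exp: "(\<lambda>x. exp (b l * x)) \<in> S" if "l < n" for l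
    using S_W[of l] that by (simp add: W_def)
  have S_ident: "(\<lambda>x. x) \<in> S" using S_W[of n] by (simp add: W_def)
  have rep: "\<exists>p\<in>polys_over R. \<exists>\<gamma>\<in>?A. \<forall>x. lift p x = exp (\<gamma> * x) * (\<Sum>i<N. poly (P i) x * exp (\<beta> i * x))"
    if "\<And>i. i < N \<Longrightarrow> P i \<in> polys_over ?A" "\<And>i. i < N \<Longrightarrow> \<beta> i \<in> ?B" for N :: nat and P \<beta>
  proof -
    have "\<exists>\<gamma>\<in>?A. (\<lambda>x. exp (\<gamma> * x) * (\<Sum>i<N. poly (P i) x * exp (\<beta> i * x))) \<in> S"
      using that(1) b(3)[OF that(2)] b(2) S_const S_ident S_exp S_add S_mult
      by (rule exp_poly_shift_natural_exponents[where n = n and b = b and S = S])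
    then obtain \<gamma> p where "\<gamma> \<in> ?A" "p \<in> polys_over R"
      "(\<lambda>x. exp (\<gamma> * x) * (\<Sum>i<N. poly (P i) x * exp (\<beta> i * x))) = lift p"
      unfolding S_def by blast
    then show ?thesis by (intro bexI[of _ p] bexI[of _ \<gamma>]) (simp_all add: fun_eq_iff)
  qed
  obtain p\<^sub>1 \<gamma>\<^sub>1 where p1: "p\<^sub>1 \<in> polys_over R" "\<gamma>\<^sub>1 \<in> ?A" "\<And>x. lift p\<^sub>1 x = exp (\<gamma>\<^sub>1 * x) * h\<^sub>1 x"
    using rep[of N\<^sub>1 P\<^sub>1 \<beta>\<^sub>1, OF h1(1)] unfolding h1(3) by auto
  obtain p\<^sub>2 \<gamma>\<^sub>2 where p2: "p\<^sub>2 \<in> polys_over R" "\<gamma>\<^sub>2 \<in> ?A" "\<And>x. lift p\<^sub>2 x = exp (\<gamma>\<^sub>2 * x) * h\<^sub>2 x"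
    using rep[of N\<^sub>2 P\<^sub>2 \<beta>\<^sub>2, OF h2(1)] unfolding h2(3) by auto
  have root: "poly p\<^sub>1 (W j \<xi>) = 0" "poly p\<^sub>2 (W j \<xi>) = 0"
    using lift_at[OF p1(1)] lift_at[OF p2(1)] p1(3) p2(3) \<xi> by simp_all
  \<comment> \<open>A nonzero polynomial with root \<open>W j \<xi>\<close> makes this value
    algebraic over \<open>R\<close>. This is where it matters that \<open>h\<^sub>1\<close> does not
    vanish identically.\<close>
  have "p\<^sub>1 \<noteq> 0"
  proof
    assume "p\<^sub>1 = 0"
    then have "h\<^sub>1 x = 0" for x using p1(3)[of x] by (simp add: lift_def)
    then show False using h(3) by auto
  qed
  then have "algebraic_over R (W j \<xi>)" using p1(1) root by (auto simp: algebraic_over_def)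
  then obtain m where m: "m \<in> polys_over R" "poly m (W j \<xi>) = 0"
    "\<And>f. f \<in> polys_over R \<Longrightarrow> poly f (W j \<xi>) = 0 \<Longrightarrow> dvd_in (polys_over R) m f"
    using R.minimal_polynomial by blast
  have quot: "\<exists>q. exp_poly q \<and> h = (\<lambda>x. lift m x * q x)"
    if p: "p \<in> polys_over R" "\<gamma> \<in> ?A" "\<And>x. lift p x = exp (\<gamma> * x) * h x" "poly p (W j \<xi>) = 0" for p \<gamma> h
  proof -
    obtain q where q: "q \<in> polys_over R" "p = m * q" using m(3)[OF p(1,4)] by (auto simp: dvd_in_def)
    \<comment> \<open>The exponential that made the exponents natural is a unit, and its inverse is
      moved to the cofactor.\<close>
    have "h x = lift m x * (exp ((- \<gamma>) * x) * lift q x)" for x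
    proof -
      have "exp (\<gamma> * x) * h x = lift m x * lift q x" using p(3)[of x] q lift_mult[OF m(1) q(1)] by simp
      then have "exp (- \<gamma> * x) * exp (\<gamma> * x) * h x = exp (- \<gamma> * x) * (lift m x * lift q x)"
        by (simp add: mult.assoc)
      then show ?thesis by (simp add: mult_ac flip: exp_add)
    qed
    moreover have "exp_poly (\<lambda>x. exp ((- \<gamma>) * x) * lift q x)"
      using p(2) q(1) by (intro exp_poly_mult exp_poly_exp lift_exp_poly algebraic_numbers.uminus_mem)
    ultimately show ?thesis by blast
  qed
  obtain q\<^sub>1 where "exp_poly q\<^sub>1" "h\<^sub>1 = (\<lambda>x. lift m x * q\<^sub>1 x)"
    using quot[OF p1 root(1)] by blast
  moreover obtain q\<^sub>2 where "exp_poly q\<^sub>2" "h\<^sub>2 = (\<lambda>x. lift m x * q\<^sub>2 x)"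
    using quot[OF p2 root(2)] by blast
  moreover have "lift m \<xi> = 0" using lift_at[OF m(1)] m(2) by simp
  ultimately show thesis using that[of "lift m"] lift_exp_poly[OF m(1)] by blast
qed

section \<open>Isolated zeros, orders of vanishing and the greatest common divisor\<close>

lemma exp_poly_eventually_nonzero:
  assumes "exp_poly f" "f \<noteq> (\<lambda>x. 0)"
  shows "\<forall>\<^sub>F x in at z. f x \<noteq> 0"
proof -
  obtain y where "f y \<noteq> 0" using assms(2) by auto
  then have "\<forall>\<^sub>F x in at z. f x \<noteq> 0 \<and> x \<in> UNIV"
    using exp_poly_holomorphic[OF assms(1)] by (intro non_zero_neighbour_alt[of f UNIV z y]) auto
  then show ?thesis by (auto elim: eventually_mono)
qed

lemma exp_poly_analytic: "exp_poly f \<Longrightarrow> f analytic_on {z}"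
  using exp_poly_holomorphic[of f UNIV] by (auto simp: analytic_at)

lemma exp_poly_ring_simps:
  "f \<in> carrier exp_poly_ring \<longleftrightarrow> exp_poly f"
  "f \<otimes>\<^bsub>exp_poly_ring\<^esub> g = (\<lambda>x. f x * g x)"
  "\<zero>\<^bsub>exp_poly_ring\<^esub> = (\<lambda>x. 0)"
  by (simp_all add: exp_poly_ring_def)

theorem theorem3:
  fixes f\<^sub>1 f\<^sub>2 g :: "complex \<Rightarrow> complex"
  assumes "schanuel_conjecture"
    and "f\<^sub>1 \<in> carrier exp_poly_ring" and "f\<^sub>1 \<noteq> \<zero>\<^bsub>exp_poly_ring\<^esub>"
    and "f\<^sub>2 \<in> carrier exp_poly_ring" and "f\<^sub>2 \<noteq> \<zero>\<^bsub>exp_poly_ring\<^esub>"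
    and "g \<in> carrier exp_poly_ring" and "g gcdof\<^bsub>exp_poly_ring\<^esub> f\<^sub>1 f\<^sub>2"
  shows
    "(\<forall>h\<^sub>1 \<in> carrier exp_poly_ring. \<forall>h\<^sub>2 \<in> carrier exp_poly_ring.
        f\<^sub>1 = g \<otimes>\<^bsub>exp_poly_ring\<^esub> h\<^sub>1 \<and> f\<^sub>2 = g \<otimes>\<^bsub>exp_poly_ring\<^esub> h\<^sub>2 \<longrightarrow>
        \<not> (\<exists>\<xi>. \<xi> \<noteq> 0 \<and> h\<^sub>1 \<xi> = 0 \<and> h\<^sub>2 \<xi> = 0)) \<and>
     {\<xi>. \<xi> \<noteq> 0 \<and> f\<^sub>1 \<xi> = 0 \<and> f\<^sub>2 \<xi> = 0} = {\<xi>. \<xi> \<noteq> 0 \<and> g \<xi> = 0} \<and>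
     (\<forall>\<xi>. \<xi> \<noteq> 0 \<and> g \<xi> = 0 \<longrightarrow> zorder g \<xi> = min (zorder f\<^sub>1 \<xi>) (zorder f\<^sub>2 \<xi>))"
proof -
  have f: "exp_poly f\<^sub>1" "f\<^sub>1 \<noteq> (\<lambda>x. 0)" "exp_poly f\<^sub>2" "f\<^sub>2 \<noteq> (\<lambda>x. 0)" and g: "exp_poly g"
    using assms by (simp_all add: exp_poly_ring_simps)
  have dvd: "a divides\<^bsub>exp_poly_ring\<^esub> b \<longleftrightarrow> (\<exists>c. exp_poly c \<and> b = (\<lambda>x. a x * c x))" for a b
    by (auto simp: factor_def exp_poly_ring_simps)
  have gcd: "\<exists>c. exp_poly c \<and> f\<^sub>1 = (\<lambda>x. g x * c x)" "\<exists>c. exp_poly c \<and> f\<^sub>2 = (\<lambda>x. g x * c x)"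
    "\<And>y. exp_poly y \<Longrightarrow> \<exists>c. exp_poly c \<and> f\<^sub>1 = (\<lambda>x. y x * c x) \<Longrightarrow>
       \<exists>c. exp_poly c \<and> f\<^sub>2 = (\<lambda>x. y x * c x) \<Longrightarrow> \<exists>c. exp_poly c \<and> g = (\<lambda>x. y x * c x)"
    using assms(7) unfolding isgcd_def dvd by (auto simp: exp_poly_ring_simps)
  have no_common_zero: "\<not> (h\<^sub>1 \<xi> = 0 \<and> h\<^sub>2 \<xi> = 0)"
    if h: "exp_poly h\<^sub>1" "exp_poly h\<^sub>2" "f\<^sub>1 = (\<lambda>x. g x * h\<^sub>1 x)" "f\<^sub>2 = (\<lambda>x. g x * h\<^sub>2 x)"
      and "\<xi> \<noteq> 0" for h\<^sub>1 h\<^sub>2 \<xi>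
  proof
    assume "h\<^sub>1 \<xi> = 0 \<and> h\<^sub>2 \<xi> = 0"
    moreover have "h\<^sub>1 \<noteq> (\<lambda>x. 0)" using f h(3) by auto
    ultimately obtain \<mu> q\<^sub>1 q\<^sub>2 where \<mu>: "exp_poly \<mu>" "exp_poly q\<^sub>1" "exp_poly q\<^sub>2" "\<mu> \<xi> = 0"
      "h\<^sub>1 = (\<lambda>x. \<mu> x * q\<^sub>1 x)" "h\<^sub>2 = (\<lambda>x. \<mu> x * q\<^sub>2 x)"
      using schanuel_common_divisor[OF assms(1) h(1,2)] \<open>\<xi> \<noteq> 0\<close> by metis
    \<comment> \<open>As \<open>\<mu>\<close> divides both cofactors, \<open>g\<close> times
      \<open>\<mu>\<close> is again a common divisor and hence divides \<open>g\<close>. So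
      \<open>\<mu>\<close> would have to be a unit although it vanishes at \<xi>.\<close>
    have "f\<^sub>1 = (\<lambda>x. g x * \<mu> x * q\<^sub>1 x)" "f\<^sub>2 = (\<lambda>x. g x * \<mu> x * q\<^sub>2 x)"
      using h(3,4) \<mu>(5,6) by (simp_all add: mult.assoc)
    then obtain c where c: "exp_poly c" "g = (\<lambda>x. g x * \<mu> x * c x)"
      using gcd(3)[OF exp_poly_mult[OF g \<mu>(1)]] \<mu>(2,3) by blast
    \<comment> \<open>The product of \<open>g\<close> and this function is zero everywhere. But at
      points close to \<xi> and different from it neither factor vanishes: this function has the
      value 1 at \<xi>, and every zero of \<open>g\<close> is one of the isolated zeros of
      \<open>f\<^sub>1\<close>.\<close>
    have "exp_poly (\<lambda>x. 1 - \<mu> x * c x)"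
      using \<mu>(1) c(1) by (intro exp_poly_diff exp_poly_mult exp_poly_const algebraic_numbers.one_mem)
    moreover have "(\<lambda>x. 1 - \<mu> x * c x) \<noteq> (\<lambda>x. 0)"
      using \<mu>(4) by (auto dest: fun_cong[of _ _ \<xi>])
    ultimately have "\<forall>\<^sub>F x in at \<xi>. 1 - \<mu> x * c x \<noteq> 0" by (rule exp_poly_eventually_nonzero)
    moreover have "\<forall>\<^sub>F x in at \<xi>. f\<^sub>1 x \<noteq> 0" using f by (intro exp_poly_eventually_nonzero)
    ultimately have "\<forall>\<^sub>F x in at \<xi>. False"
    proof eventually_elim
      case (elim x)
      then have "g x \<noteq> 0" using h(3) by auto
      moreover have "g x = g x * (\<mu> x * c x)" using fun_cong[OF c(2), of x] by (simp add: mult.assoc)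
      ultimately show False using elim(1) by simp
    qed
    then show False by simp
  qed
  obtain h\<^sub>1 h\<^sub>2 where h: "exp_poly h\<^sub>1" "exp_poly h\<^sub>2" "f\<^sub>1 = (\<lambda>x. g x * h\<^sub>1 x)" "f\<^sub>2 = (\<lambda>x. g x * h\<^sub>2 x)"
    using gcd(1,2) by blast
  have order: "zorder f \<xi> = zorder g \<xi> + zorder h \<xi>" "zorder h \<xi> \<ge> 0" "h \<xi> \<noteq> 0 \<Longrightarrow> zorder h \<xi> = 0"
    if "exp_poly f" "exp_poly h" "f = (\<lambda>x. g x * h x)" "f \<noteq> (\<lambda>x. 0)" for f h \<xi>
  proof -
    have "\<forall>\<^sub>F x in at \<xi>. g x * h x \<noteq> 0"
      using exp_poly_eventually_nonzero[OF that(1,4)] that(3) by simp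
    then show "zorder f \<xi> = zorder g \<xi> + zorder h \<xi>"
      unfolding that(3) by (intro zorder_times_analytic exp_poly_analytic g that)
    have "h \<noteq> (\<lambda>x. 0)" using that(3,4) by auto
    then have "\<forall>\<^sub>F x in at \<xi>. h x \<noteq> 0" by (rule exp_poly_eventually_nonzero[OF that(2)])
    then show "zorder h \<xi> \<ge> 0"
      by (intro zorder_ge_0 exp_poly_analytic that(2) eventually_frequently) auto
    show "zorder h \<xi> = 0" if "h \<xi> \<noteq> 0"
      using that exp_poly_analytic[OF \<open>exp_poly h\<close>] by (intro zorder_eq_0I)
  qed
  \<comment> \<open>The orders of \<open>f\<^sub>1\<close> and \<open>f\<^sub>2\<close> exceed that
    of \<open>g\<close> by the orders of the cofactors. These are nonnegative, and one of them is 0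
    because the cofactors do not both vanish at \<xi>.\<close>
  have "zorder g \<xi> = min (zorder f\<^sub>1 \<xi>) (zorder f\<^sub>2 \<xi>)" if "\<xi> \<noteq> 0" for \<xi>
    using order[OF f(1) h(1,3) f(2), of \<xi>] order[OF f(3) h(2,4) f(4), of \<xi>]
      no_common_zero[OF h that] by auto
  moreover have "{\<xi>. \<xi> \<noteq> 0 \<and> f\<^sub>1 \<xi> = 0 \<and> f\<^sub>2 \<xi> = 0} = {\<xi>. \<xi> \<noteq> 0 \<and> g \<xi> = 0}"
    using no_common_zero[OF h] unfolding h(3,4) by auto
  ultimately show ?thesis
    using no_common_zero by (auto simp: exp_poly_ring_simps)
qed

end
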